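(* Let $D$ be a domain in $\mathbb{R}^N$, $N\geq 2$. Let $u: D\to[-\infty,\infty)$ be a function such that there are $x_1,x_2\in D$ with $$u(x_1)>0>u(x_2).$$ Then $u$ is harmonic in $D$ if and only if the functions $u$ and $-u$ are both quasinearly subharmonic n.s. in $D$.
   Context: $B^N(x,r)$ is the open ball in $\mathbb{R}^N$ with center $x$ and radius $r>0$, $\overline{B^N(x,r)}$ its closure, $m_N$ is Lebesgue measure on $\mathbb{R}^N$, $\nu_N$ is the volume of the unit ball of $\mathbb{R}^N$, and $u^+=\max\{u,0\}$. For $K\geq 1$, a function $u: D\to[-\infty,+\infty)$ is called $K$-quasinearly subharmonic n.s. (in the narrow sense) in $D$ if $u$ is Lebesgue measurable, $u^+\in\mathcal{L}^1_{\mathrm{loc}}(D)$, and $$u(x)\leq \frac{K}{\nu_N r^N}\int_{B^N(x,r)}u(y)\,dm_N(y)$$ for all closed balls $\overline{B^N(x,r)}\subset D$ (the integral may equal $-\infty$). A function is quasinearly subharmonic n.s. in $D$ if it is $K$-quasinearly subharmonic n.s. in $D$ for some $K\geq 1$; the constants for $u$ and for $-u$ are allowed to be different. In particular, for $-u$ to be quasinearly subharmonic n.s. it must take values in $[-\infty,+\infty)$, i.e. $u$ never takes the value $-\infty$. *)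

theory Defs
  imports "HOL-Analysis.Analysis"
begin

text \<open>
  Functions on a set \<open>D\<close> are total functions whose values outside \<open>D\<close> are irrelevant; \<open>D\<close> is
  meant to be open. Derivatives are taken at points of \<open>D\<close> with respect to the full
  neighbourhood filter and so depend only on the values on \<open>D\<close>.
\<close>

definition partial_deriv :: "'a \<Rightarrow> ('a::euclidean_space \<Rightarrow> real) \<Rightarrow> 'a \<Rightarrow> real" where
  "partial_deriv i f x = frechet_derivative f (at x) i"

primrec Ck_on :: "nat \<Rightarrow> ('a::euclidean_space \<Rightarrow> real) \<Rightarrow> 'a set \<Rightarrow> bool" where
  "Ck_on 0 f D \<longleftrightarrow> continuous_on D f"
| "Ck_on (Suc k) f D \<longleftrightarrow>
     (\<forall>x\<in>D. f differentiable (at x)) \<and> (\<forall>i\<in>Basis. Ck_on k (partial_deriv i f) D)"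

definition laplacian :: "('a::euclidean_space \<Rightarrow> real) \<Rightarrow> 'a \<Rightarrow> real" where
  "laplacian f x = (\<Sum>i\<in>Basis. partial_deriv i (partial_deriv i f) x)"

definition harmonic_on :: "('a::euclidean_space \<Rightarrow> real) \<Rightarrow> 'a set \<Rightarrow> bool" where
  "harmonic_on f D \<longleftrightarrow> Ck_on 2 f D \<and> (\<forall>x\<in>D. laplacian f x = 0)"

text \<open>A harmonic function is real-valued, so an extended real-valued one must be finite on \<open>D\<close>.\<close>

definition ereal_harmonic_on :: "('a::euclidean_space \<Rightarrow> ereal) \<Rightarrow> 'a set \<Rightarrow> bool" where
  "ereal_harmonic_on u D \<longleftrightarrow>
     (\<forall>x\<in>D. \<bar>u x\<bar> \<noteq> \<infinity>) \<and> harmonic_on (\<lambda>x. real_of_ereal (u x)) D"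

text \<open>
  The Lebesgue integral over \<open>A\<close> as the integral of the positive part minus that of the negative
  part; it may equal \<open>-\<infinity>\<close>. The library's value \<open>\<infinity> - \<infinity> = \<infinity>\<close> plays no role below, where the
  integral of the positive part is always finite.
\<close>

definition ereal_integral_on :: "'a::euclidean_space set \<Rightarrow> ('a \<Rightarrow> ereal) \<Rightarrow> ereal" where
  "ereal_integral_on A u =
     enn2ereal (\<integral>\<^sup>+y\<in>A. e2ennreal (max (u y) 0) \<partial>lebesgue)
     - enn2ereal (\<integral>\<^sup>+y\<in>A. e2ennreal (max (- u y) 0) \<partial>lebesgue)"

definition pos_part_locally_integrable_on ::
    "('a::euclidean_space \<Rightarrow> ereal) \<Rightarrow> 'a set \<Rightarrow> bool" where
  "pos_part_locally_integrable_on u D \<longleftrightarrow>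
     (\<forall>C. compact C \<and> C \<subseteq> D \<longrightarrow> (\<integral>\<^sup>+y\<in>C. e2ennreal (max (u y) 0) \<partial>lebesgue) < \<infinity>)"

definition K_quasinearly_subharmonic_ns ::
    "real \<Rightarrow> ('a::euclidean_space \<Rightarrow> ereal) \<Rightarrow> 'a set \<Rightarrow> bool" where
  "K_quasinearly_subharmonic_ns K u D \<longleftrightarrow>
     (\<forall>x\<in>D. u x \<noteq> \<infinity>) \<and>
     u \<in> borel_measurable (lebesgue_on D) \<and>
     pos_part_locally_integrable_on u D \<and>
     (\<forall>x r. r > 0 \<and> cball x r \<subseteq> D \<longrightarrow>
        u x \<le> ereal (K / (measure lebesgue (ball (0::'a) 1) * r ^ DIM('a)))
                * ereal_integral_on (ball x r) u)"

definition quasinearly_subharmonic_ns ::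
    "('a::euclidean_space \<Rightarrow> ereal) \<Rightarrow> 'a set \<Rightarrow> bool" where
  "quasinearly_subharmonic_ns u D \<longleftrightarrow> (\<exists>K\<ge>1. K_quasinearly_subharmonic_ns K u D)"

end

theory Submission
  imports Defs
begin

text \<open>
  Write \<open>A(x,r)\<close> for the mean of \<open>u\<close> over the ball of centre \<open>x\<close> and radius \<open>r\<close>. The two
  quasi-subharmonicity conditions say \<open>K2 * A(x,r) \<le> u x \<le> K1 * A(x,r)\<close>. Where \<open>u > 0\<close> this forces
  \<open>K2 \<le> K1\<close>, and where \<open>u < 0\<close> it forces \<open>K1 \<le> K2\<close>; hence \<open>u x = K * A(x,r)\<close> for all balls. So
  \<open>u\<close> is continuous, letting \<open>r\<close> tend to \<open>0\<close> gives \<open>K = 1\<close>, and \<open>u\<close> has the mean value property.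

  The equivalence of harmonicity and the mean value property over balls is proved without surface
  integrals, by means of the kernels \<open>(R\<^sup>2 - \<bar>z\<bar>\<^sup>2)\<^sub>+ ^ k\<close>. Let \<open>J k R\<close> be the integral of
  \<open>f y - f x\<close> against the kernel centred at \<open>x\<close>. Then \<open>J (k+1)' R = 2 * (k+1) * R * J k R\<close>, and the
  divergence theorem gives \<open>8 * R\<^sup>2 * J 0 R - (4 * N + 8) * J 1 R\<close> as the integral of
  \<open>laplacian f\<close> against the kernel with \<open>k = 2\<close>.
\<close>

subsection \<open>Differentiation under the integral sign\<close>

text \<open>One derivative, in the radius or in space, lowers the exponent \<open>k\<close> of the
  kernel by one. Integrating upwards from radius \<open>0\<close>, the vanishing of
  \<open>J 0\<close> therefore gives that of every \<open>J k\<close>, and \<open>k = 3\<close> is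
  smooth enough to regularise. In the identity for the Laplacian, harmonicity leaves the linear
  equation \<open>R * J 1' = (N + 2) * J 1\<close>; conversely, the mean value property makes the
  \<open>J\<close> terms vanish, so the weighted integral of the Laplacian is \<open>0\<close> on
  all small balls. The price is that the kernel jumps on the sphere for \<open>k = 0\<close> and has
  a corner there for \<open>k = 1\<close>. Differentiation under the integral is therefore based on
  a Lipschitz bound and on a derivative that exists almost everywhere, in one form that serves
  radii, translations and convolutions alike.\<close>

lemma has_derivative_integral_dominated:
  fixes g :: "'a::euclidean_space \<Rightarrow> 'b \<Rightarrow> real"
  assumes U: "open U" "a \<in> U"
    and int: "\<And>x. x \<in> U \<Longrightarrow> integrable M (g x)"
    and L: "integrable M L"
    and lip: "\<And>x y. x \<in> U \<Longrightarrow> y \<in> space M \<Longrightarrow> \<bar>g x y - g a y\<bar> \<le> L y * norm (x - a)"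
    and der: "AE y in M. ((\<lambda>x. g x y) has_derivative (\<lambda>h. h \<bullet> G y)) (at a)"
    and G: "integrable M G"
  shows "((\<lambda>x. \<integral>y. g x y \<partial>M) has_derivative (\<lambda>h. h \<bullet> (\<integral>y. G y \<partial>M))) (at a)"
proof -
  \<comment> \<open>\<open>Q\<close> is the normalised remainder of the linear approximation at
    \<open>a\<close>. The Lipschitz bound and Cauchy-Schwarz dominate it by
    \<open>L y + norm (G y)\<close> uniformly in \<open>x\<close>, so its pointwise limit
    \<open>0\<close> passes through the integral.\<close>
  define Q where "Q x y = (g x y - g a y - (x - a) \<bullet> G y) / norm (x - a)" for x y
  have Qint: "integrable M (Q x)" if "x \<in> U" for x
    unfolding Q_def using that int U(2) G by (intro integrable_divide_zero integrable_diff) auto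
  have bound: "norm (Q x y) \<le> L y + norm (G y)" if "x \<in> U" "x \<noteq> a" "y \<in> space M" for x y
  proof -
    have "\<bar>g x y - g a y - (x - a) \<bullet> G y\<bar> \<le> \<bar>g x y - g a y\<bar> + \<bar>(x - a) \<bullet> G y\<bar>"
      by linarith
    also have "\<dots> \<le> L y * norm (x - a) + norm (x - a) * norm (G y)"
      by (intro add_mono lip Cauchy_Schwarz_ineq2 that)
    finally show ?thesis
      using that by (simp add: Q_def divide_simps algebra_simps)
  qed
  have lim: "((\<lambda>x. \<integral>y. Q x y \<partial>M) \<longlongrightarrow> (\<integral>y. 0 \<partial>M)) (at a)"
    unfolding tendsto_at_iff_sequentially comp_def
  proof (intro allI impI)
    fix X assume X: "\<forall>i. X i \<in> UNIV - {a}" and Xa: "X \<longlonglongrightarrow> a"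
    have "eventually (\<lambda>n. X n \<in> U) sequentially"
      using topological_tendstoD[OF Xa U] .
    \<comment> \<open>The domination is available only inside \<open>U\<close>, so the sequence is
      shifted past its first \<open>n0\<close> terms.\<close>
    then obtain n0 where n0: "\<And>n. n \<ge> n0 \<Longrightarrow> X n \<in> U"
      by (auto simp: eventually_sequentially)
    have "(\<lambda>n. \<integral>y. Q (X (n + n0)) y \<partial>M) \<longlonglongrightarrow> (\<integral>y. 0 \<partial>M)"
    proof (rule integral_dominated_convergence)
      show "integrable M (\<lambda>y. L y + norm (G y))" using L G by auto
      show "AE y in M. (\<lambda>n. Q (X (n + n0)) y) \<longlonglongrightarrow> 0"
        using der
      proof eventually_elim
        case (elim y)
        then have "((\<lambda>x. norm (g x y - g a y - (x - a) \<bullet> G y) / norm (x - a)) \<longlongrightarrow> 0) (at a)"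
          by (subst (asm) has_derivative_iff_norm) blast
        moreover have "norm (g x y - g a y - (x - a) \<bullet> G y) / norm (x - a) = norm (Q x y)" for x
          by (simp add: Q_def)
        ultimately have "((\<lambda>x. Q x y) \<longlongrightarrow> 0) (at a)"
          by (simp add: tendsto_rabs_zero_iff)
        then have "(\<lambda>n. Q (X n) y) \<longlonglongrightarrow> 0"
          using X Xa unfolding tendsto_at_iff_sequentially comp_def by blast
        then show ?case by (rule LIMSEQ_ignore_initial_segment)
      qed
    qed (use n0 Qint bound X in \<open>auto intro!: AE_I2\<close>)
    then show "(\<lambda>n. \<integral>y. Q (X n) y \<partial>M) \<longlonglongrightarrow> (\<integral>y. 0 \<partial>M)"
      by (rule LIMSEQ_offset)
  qed
  have "\<forall>\<^sub>F x in at a. (\<integral>y. Q x y \<partial>M) =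
      ((\<integral>y. g x y \<partial>M) - (\<integral>y. g a y \<partial>M) - (x - a) \<bullet> (\<integral>y. G y \<partial>M)) / norm (x - a)"
    using topological_tendstoD[OF tendsto_ident_at U]
    by eventually_elim (use int U(2) G in \<open>simp add: Q_def\<close>)
  with lim have "((\<lambda>x. ((\<integral>y. g x y \<partial>M) - (\<integral>y. g a y \<partial>M) - (x - a) \<bullet> (\<integral>y. G y \<partial>M)) / norm (x - a)) \<longlongrightarrow> 0) (at a)"
    by (simp add: tendsto_cong)
  then show ?thesis
    unfolding has_derivative_iff_norm
    by (auto intro: bounded_linear_inner_left dest: tendsto_norm)
qed

lemma lborel_integral_translate:
  fixes f :: "'a::euclidean_space \<Rightarrow> real"
  assumes "integrable lborel f"
  shows "integrable lborel (\<lambda>y. f (y + c))" "(\<integral>y. f (y + c) \<partial>lborel) = (\<integral>y. f y \<partial>lborel)"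
proof -
  have distr: "distr lborel lborel (\<lambda>y. y + c) = lborel"
    using lborel_distr_plus[of c] by (metis (no_types, lifting) add.commute distr_cong ext sets_lborel)
  have meas: "(\<lambda>y. y + c) \<in> lborel \<rightarrow>\<^sub>M lborel" by simp
  show "integrable lborel (\<lambda>y. f (y + c))"
    using integrable_distr_eq[OF meas, of f] assms unfolding distr by auto
  show "(\<integral>y. f (y + c) \<partial>lborel) = (\<integral>y. f y \<partial>lborel)"
    using integral_distr[OF meas, of f] assms unfolding distr by auto
qed

text \<open>By translation invariance the integral of \<open>V (y + t *\<^sub>R e)\<close> does not
  depend on \<open>t\<close>; differentiating under the integral at \<open>t = 0\<close> produces
  the integral of \<open>W\<close>. This takes the place of the divergence theorem and tolerates a
  corner of \<open>V\<close> along a sphere.\<close>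

lemma integral_directional_derivative_eq_0:
  fixes V :: "'a::euclidean_space \<Rightarrow> real"
  assumes V: "integrable lborel V" and W: "integrable lborel W"
    and supp: "\<And>y. y \<notin> cball x R \<Longrightarrow> V y = 0"
    and lip: "\<And>y y'. \<bar>V y' - V y\<bar> \<le> L * dist y y'"
    and der: "AE y in lborel. ((\<lambda>t. V (y + t *\<^sub>R e)) has_real_derivative W y) (at 0)"
  shows "(\<integral>y. W y \<partial>lborel) = 0"
proof -
  \<comment> \<open>For \<open>\<bar>t\<bar> < 1\<close> the shift moves points by at most
    \<open>norm e\<close>, so outside \<open>B\<close> both \<open>V y\<close> and
    \<open>V (y + t *\<^sub>R e)\<close> vanish, and the Lipschitz bound can be cut off by the
    indicator of \<open>B\<close>.\<close>
  define B where "B = cball x (R + norm e)"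
  have int: "integrable lborel (\<lambda>y. V (y + t *\<^sub>R e))" for t
    using V by (rule lborel_integral_translate)
  have const: "(\<integral>y. V (y + t *\<^sub>R e) \<partial>lborel) = (\<integral>y. V y \<partial>lborel)" for t
    using V by (rule lborel_integral_translate)
  have "((\<lambda>t. \<integral>y. V (y + t *\<^sub>R e) \<partial>lborel) has_derivative (\<lambda>h. h \<bullet> (\<integral>y. W y \<partial>lborel))) (at 0)"
  proof (rule has_derivative_integral_dominated[where U = "ball 0 1"
        and L = "\<lambda>y. L * norm e * indicator B y"])
    show "integrable lborel (\<lambda>y. L * norm e * indicator B y)"
      by (intro integrable_mult_right)
        (simp add: B_def emeasure_bounded_finite[unfolded infinity_ennreal_def] integrable_indicator_iff)
    fix t :: real and y assume t: "t \<in> ball 0 1"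
    show "\<bar>V (y + t *\<^sub>R e) - V (y + 0 *\<^sub>R e)\<bar> \<le> L * norm e * indicator B y * norm (t - 0)"
    proof (cases "y \<in> B")
      case True
      then show ?thesis using lip[of "y + t *\<^sub>R e" y]
        by (simp add: dist_norm mult_ac)
    next
      case False
      have "norm (t *\<^sub>R e) \<le> norm e"
        using t by (simp add: mult_left_le_one_le)
      moreover have "dist x y \<le> dist x (y + t *\<^sub>R e) + norm (t *\<^sub>R e)"
        by (metis add.commute add_diff_cancel_left' dist_commute dist_norm dist_triangle)
      ultimately have "y + t *\<^sub>R e \<notin> cball x R" "y \<notin> cball x R"
        using False norm_ge_zero[of e] unfolding B_def mem_cball by linarith+
      then show ?thesis using False supp by simp
    qed
  next
    show "AE y in lborel. ((\<lambda>t. V (y + t *\<^sub>R e)) has_derivative (\<lambda>h. h \<bullet> W y)) (at 0)"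
      using der by eventually_elim (auto simp: has_field_derivative_def fun_eq_iff elim!: has_derivative_eq_rhs)
  qed (use int W in auto)
  moreover have "((\<lambda>t. \<integral>y. V (y + t *\<^sub>R e) \<partial>lborel) has_derivative (\<lambda>h. 0)) (at 0)"
    unfolding const by simp
  ultimately have "(\<lambda>h. h \<bullet> (\<integral>y. W y \<partial>lborel)) = (\<lambda>h. 0)"
    by (rule has_derivative_unique)
  from fun_cong[OF this, of 1] show ?thesis by simp
qed

subsection \<open>The kernels\<close>

text \<open>The value at \<open>s = 0\<close> is \<open>0\<close> even for \<open>k = 0\<close>, so that \<open>bump 0 R\<close> is the indicator of the open ball.\<close>

definition pos_power :: "nat \<Rightarrow> real \<Rightarrow> real" where
  "pos_power k s = (if 0 < s then s ^ k else 0)"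

definition bump :: "nat \<Rightarrow> real \<Rightarrow> 'a::euclidean_space \<Rightarrow> real" where
  "bump k R z = pos_power k (R\<^sup>2 - (norm z)\<^sup>2)"

lemma pos_power_Suc: "pos_power (Suc k) s = (max 0 s) ^ Suc k"
  by (auto simp: pos_power_def max_def)

lemma pos_power_mult: "s * pos_power k s = pos_power (Suc k) s"
  by (simp add: pos_power_def)

text \<open>The excluded case \<open>s = 0\<close>, \<open>k = 0\<close> is the corner of
  \<open>max 0 s\<close>. At \<open>s = 0\<close> with \<open>k > 0\<close> the difference quotient
  is at most \<open>\<bar>h\<bar> ^ k\<close>, which tends to \<open>0\<close>.\<close>

lemma DERIV_pos_power:
  assumes "s \<noteq> 0 \<or> k > 0"
  shows "(pos_power (Suc k) has_real_derivative real (Suc k) * pos_power k s) (at s)"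
proof -
  consider "s < 0" | "s > 0" | "s = 0" "k > 0" using assms by linarith
  then show ?thesis
  proof cases
    case 1
    have "((\<lambda>_. 0) has_real_derivative 0) (at s)" by simp
    then have "(pos_power (Suc k) has_real_derivative 0) (at s)"
      by (rule has_field_derivative_transform_within_open[of _ _ _ "{..<0}"])
        (use 1 in \<open>auto simp: pos_power_def\<close>)
    then show ?thesis using 1 by (simp add: pos_power_def)
  next
    case 2
    have "((\<lambda>s. s ^ Suc k) has_real_derivative real (Suc k) * s ^ k) (at s)"
      by (rule derivative_eq_intros | simp)+
    then have "(pos_power (Suc k) has_real_derivative real (Suc k) * s ^ k) (at s)"
      by (rule has_field_derivative_transform_within_open[of _ _ _ "{0<..}"])
        (use 2 in \<open>auto simp: pos_power_def\<close>)
    then show ?thesis using 2 by (simp add: pos_power_def)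
  next
    case 3
    have "(\<lambda>h. pos_power (Suc k) h / h) \<midarrow>0\<rightarrow> 0"
    proof (rule Lim_null_comparison)
      show "\<forall>\<^sub>F h in at 0. norm (pos_power (Suc k) h / h) \<le> \<bar>h\<bar> ^ k"
        by (intro always_eventually) (auto simp: pos_power_def)
      have "((\<lambda>h::real. \<bar>h\<bar> ^ k) \<longlongrightarrow> \<bar>0\<bar> ^ k) (at 0)"
        by (intro tendsto_intros)
      then show "((\<lambda>h::real. \<bar>h\<bar> ^ k) \<longlongrightarrow> 0) (at 0)" using 3 by (simp add: power_0_left del: tendsto_rabs_zero_iff)
    qed
    then show ?thesis using 3
      by (simp add: has_field_derivative_iff pos_power_def)
  qed
qed

text \<open>Truncation by \<open>max 0\<close> is 1-Lipschitz and maps into \<open>{0..S}\<close>,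
  where the slope of the power is at most \<open>Suc k * S ^ k\<close>. The case
  \<open>k = 0\<close> is included, so difference quotients across the corner are dominated as
  well.\<close>

lemma pos_power_lipschitz:
  assumes "s \<le> S" "t \<le> S" "0 \<le> S"
  shows "\<bar>pos_power (Suc k) s - pos_power (Suc k) t\<bar> \<le> real (Suc k) * S ^ k * \<bar>s - t\<bar>"
proof -
  have "norm ((max 0 s) ^ Suc k - (max 0 t) ^ Suc k) \<le> (real (Suc k) * S ^ k) * norm (max 0 s - max 0 t)"
  proof (rule field_differentiable_bound[where S = "{0..S}"])
    show "((\<lambda>x. x ^ Suc k) has_field_derivative real (Suc k) * z ^ k) (at z within {0..S})" for z :: real
      by (rule derivative_eq_intros | simp)+
    show "norm (real (Suc k) * z ^ k) \<le> real (Suc k) * S ^ k" if "z \<in> {0..S}" for z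
      using that by (auto simp: abs_mult power_mono simp del: of_nat_Suc)
  qed (use assms in auto)
  also have "\<dots> \<le> real (Suc k) * S ^ k * \<bar>s - t\<bar>"
    using assms by (intro mult_left_mono) auto
  finally show ?thesis by (simp add: pos_power_Suc)
qed

lemma bump_nonneg: "0 \<le> bump k R z"
  by (simp add: bump_def pos_power_def)

lemma bump_outside: "R \<le> norm z \<Longrightarrow> 0 \<le> R \<Longrightarrow> bump k R z = 0"
  by (simp only: bump_def pos_power_def diff_gt_0_iff_gt not_less power_mono if_not_P)

lemma bump_inside: "norm z < R \<Longrightarrow> bump k R z = (R\<^sup>2 - (norm z)\<^sup>2) ^ k"
  by (simp add: bump_def pos_power_def power_strict_mono)

lemma bump_0: "0 \<le> R \<Longrightarrow> bump 0 R z = indicator (ball 0 R) z"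
  by (cases "norm z < R") (auto simp: bump_inside bump_outside)

lemma bump_mult: "(R\<^sup>2 - (norm z)\<^sup>2) * bump k R z = bump (Suc k) R z"
  by (simp add: bump_def pos_power_mult)

lemma bump_le: "bump k R z \<le> (R\<^sup>2) ^ k"
  by (auto simp: bump_def pos_power_def intro: power_mono)

lemma bump_minus: "bump k R (x - y) = bump k R (y - x)"
  by (simp add: bump_def norm_minus_commute)

lemma bump_measurable [measurable]: "bump k R \<in> borel_measurable borel"
  unfolding bump_def[abs_def] pos_power_def by measurable

lemma continuous_on_bump:
  fixes A :: "'a::euclidean_space set"
  assumes "k > 0"
  shows "continuous_on A (bump k R)"
proof (cases k)
  case (Suc m)
  have "bump (Suc m) R = (\<lambda>z::'a. (max 0 (R\<^sup>2 - (norm z)\<^sup>2)) ^ Suc m)"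
    by (simp add: fun_eq_iff bump_def pos_power_Suc)
  moreover have "continuous_on A \<dots>" by (intro continuous_intros)
  ultimately show ?thesis by (simp only: Suc)
qed (use assms in simp)

lemma has_derivative_bump:
  assumes "norm z \<noteq> \<bar>R\<bar> \<or> k > 0"
  shows "(bump (Suc k) R has_derivative (\<lambda>h. h \<bullet> ((- 2 * real (Suc k) * bump k R z) *\<^sub>R z))) (at z)"
proof -
  have nz: "R\<^sup>2 - (norm z)\<^sup>2 \<noteq> 0 \<or> k > 0"
    using assms by (metis abs_norm_cancel eq_iff_diff_eq_0 power2_eq_iff abs_of_nonneg abs_minus_cancel abs_abs norm_ge_zero abs_eq_iff)
  have q: "((\<lambda>z. R\<^sup>2 - (norm z)\<^sup>2) has_derivative (\<lambda>h. - 2 * (h \<bullet> z))) (at z)"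
    unfolding power2_norm_eq_inner
    by (rule derivative_eq_intros refl)+ (simp add: fun_eq_iff inner_commute)
  have "(pos_power (Suc k) has_derivative (*) (real (Suc k) * pos_power k (R\<^sup>2 - (norm z)\<^sup>2)))
      (at (R\<^sup>2 - (norm z)\<^sup>2))"
    using DERIV_pos_power[OF nz] unfolding has_field_derivative_def .
  from diff_chain_at[OF q this] show ?thesis
    unfolding bump_def[abs_def] comp_def by (rule has_derivative_eq_rhs) (auto simp: fun_eq_iff algebra_simps)
qed

text \<open>The kernel depends on \<open>R\<close> only through its square, so \<open>R\<close>
  ranges over all reals; hence \<open>\<bar>R\<bar>\<close> in the condition.\<close>

lemma DERIV_bump_radius:
  assumes "norm z \<noteq> \<bar>R\<bar> \<or> k > 0"
  shows "((\<lambda>R. bump (Suc k) R z) has_real_derivative 2 * real (Suc k) * R * bump k R z) (at R)"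
proof -
  have nz: "R\<^sup>2 - (norm z)\<^sup>2 \<noteq> 0 \<or> k > 0"
    using assms by (metis abs_norm_cancel eq_iff_diff_eq_0 power2_eq_iff abs_of_nonneg abs_minus_cancel abs_abs norm_ge_zero abs_eq_iff)
  have q: "((\<lambda>R. R\<^sup>2 - (norm z)\<^sup>2) has_real_derivative 2 * R) (at R)"
    by (rule derivative_eq_intros refl | simp)+
  from DERIV_chain2[OF DERIV_pos_power[OF nz] q] show ?thesis
    unfolding bump_def[abs_def] by (simp add: algebra_simps)
qed

text \<open>The sphere carries the jump of \<open>bump 0\<close> and the corner of
  \<open>bump 1\<close>. That it is a null set is what turns the pointwise derivatives and limits of
  these kernels into statements almost everywhere.\<close>

lemma AE_not_sphere: "AE y::'a::euclidean_space in lborel. norm (x - y) \<noteq> R"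
proof -
  have "sphere x R \<in> null_sets lborel"
    using negligible_sphere[of x R]
    by (simp add: negligible_iff_null_sets null_sets_completion_iff)
  then have "AE y in lborel. y \<notin> sphere x R" by (rule AE_not_in)
  then show ?thesis by eventually_elim (simp add: dist_norm)
qed

lemma integrable_times_bump:
  fixes H :: "'a::euclidean_space \<Rightarrow> real"
  assumes H: "integrable lborel H"
  shows "integrable lborel (\<lambda>y. H y * bump k R (x - y))"
proof (rule Bochner_Integration.integrable_bound)
  show "integrable lborel (\<lambda>y. (R\<^sup>2) ^ k * H y)" using H by simp
  show "AE y in lborel. norm (H y * bump k R (x - y)) \<le> norm ((R\<^sup>2) ^ k * H y)"
    by (auto intro!: AE_I2 mult_right_mono simp: abs_mult bump_nonneg mult.commute[of "\<bar>H _\<bar>"] bump_le)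
qed (use H in measurable)

text \<open>The radius occurs only in the kernel, so all smoothness comes from there and
  integrability of \<open>H\<close> is enough.\<close>

lemma DERIV_integral_bump:
  fixes H :: "'a::euclidean_space \<Rightarrow> real"
  assumes H: "integrable lborel H"
  shows "((\<lambda>R. \<integral>y. H y * bump (Suc k) R (x - y) \<partial>lborel) has_real_derivative
      2 * real (Suc k) * R * (\<integral>y. H y * bump k R (x - y) \<partial>lborel)) (at R)"
proof -
  \<comment> \<open>\<open>S\<close> bounds the squares of all radii within distance
    \<open>1\<close> of \<open>R\<close>. In \<open>L\<close>, the factor
    \<open>2 * \<bar>R\<bar> + 1\<close> bounds \<open>\<bar>r + R\<bar>\<close> in the
    factorisation of \<open>r\<^sup>2 - R\<^sup>2\<close>.\<close>
  define S where "S = (\<bar>R\<bar> + 1)\<^sup>2"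
  define L where "L = real (Suc k) * S ^ k * (2 * \<bar>R\<bar> + 1)"
  have "((\<lambda>R. \<integral>y. H y * bump (Suc k) R (x - y) \<partial>lborel) has_derivative
      (\<lambda>h. h \<bullet> (\<integral>y. 2 * real (Suc k) * R * (H y * bump k R (x - y)) \<partial>lborel))) (at R)"
  proof (rule has_derivative_integral_dominated[where U = "ball R 1" and L = "\<lambda>y. L * \<bar>H y\<bar>"])
    show "AE y in lborel. ((\<lambda>R. H y * bump (Suc k) R (x - y)) has_derivative
        (\<lambda>h. h \<bullet> (2 * real (Suc k) * R * (H y * bump k R (x - y))))) (at R)"
      using AE_not_sphere[of x "\<bar>R\<bar>"]
    proof eventually_elim
      case (elim y)
      show ?case
        using DERIV_cmult[OF DERIV_bump_radius[of "x - y" R k], of "H y"] elim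
        unfolding has_field_derivative_def
        by (auto elim!: has_derivative_eq_rhs simp: fun_eq_iff)
    qed
    fix r y assume r: "r \<in> ball R 1"
    let ?a = "(norm (x - y))\<^sup>2"
    have r': "\<bar>r\<bar> \<le> \<bar>R\<bar> + 1" "\<bar>r - R\<bar> \<le> 1" using r by (auto simp: dist_real_def)
    have "r\<^sup>2 \<le> S" "R\<^sup>2 \<le> S"
      using r' unfolding S_def by (auto simp flip: abs_le_square_iff)
    then have "\<bar>bump (Suc k) r (x - y) - bump (Suc k) R (x - y)\<bar>
        \<le> real (Suc k) * S ^ k * \<bar>(r\<^sup>2 - ?a) - (R\<^sup>2 - ?a)\<bar>"
      unfolding bump_def
      by (intro pos_power_lipschitz) (smt (verit) zero_le_power2)+
    also have "(r\<^sup>2 - ?a) - (R\<^sup>2 - ?a) = (r + R) * (r - R)"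
      by (simp add: power2_eq_square algebra_simps)
    also have "real (Suc k) * S ^ k * \<bar>(r + R) * (r - R)\<bar>
        \<le> real (Suc k) * S ^ k * ((2 * \<bar>R\<bar> + 1) * \<bar>r - R\<bar>)"
      using r' by (intro mult_left_mono) (auto simp: abs_mult S_def intro!: mult_right_mono)
    finally have "\<bar>H y\<bar> * \<bar>bump (Suc k) r (x - y) - bump (Suc k) R (x - y)\<bar> \<le> \<bar>H y\<bar> * (L * \<bar>r - R\<bar>)"
      by (intro mult_left_mono) (auto simp: L_def mult.assoc)
    then show "\<bar>H y * bump (Suc k) r (x - y) - H y * bump (Suc k) R (x - y)\<bar>
        \<le> L * \<bar>H y\<bar> * norm (r - R)"
      by (simp add: abs_mult mult_ac flip: right_diff_distrib)
  qed (use integrable_times_bump[OF H] H in auto)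
  then show ?thesis
    by (auto simp: has_field_derivative_def elim!: has_derivative_eq_rhs)
qed

lemma integrable_bounded_support:
  fixes f :: "'a::euclidean_space \<Rightarrow> real"
  assumes "f \<in> borel_measurable borel" "\<And>y. \<bar>f y\<bar> \<le> B" "\<And>y. y \<notin> S \<Longrightarrow> f y = 0" "bounded S"
  shows "integrable lborel f"
proof -
  obtain a b where ab: "S \<subseteq> cbox a b"
    using \<open>bounded S\<close> bounded_subset_cbox_symmetric by metis
  show ?thesis
  proof (rule Bochner_Integration.integrable_bound)
    show "integrable lborel (\<lambda>y. B * indicator (cbox a b) y)"
      by (intro integrable_mult_right) (simp add: integrable_indicator_iff emeasure_lborel_cbox_eq)
    have "\<bar>f y\<bar> \<le> \<bar>B * indicator (cbox a b) y\<bar>" for y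
      using assms(2,3)[of y] ab by (auto simp: indicator_def)
    then show "AE y in lborel. norm (f y) \<le> norm (B * indicator (cbox a b) y)"
      by simp
  qed (use assms(1) in simp)
qed

section \<open>Convolution of an integrable function with a continuous kernel of compact
  support\<close>

lemma continuous_compact_support_bounded:
  fixes f :: "'a::euclidean_space \<Rightarrow> 'b::real_normed_vector"
  assumes "continuous_on UNIV f" "\<And>z. R \<le> norm z \<Longrightarrow> f z = 0"
  obtains B where "B \<ge> 0" "\<And>z. norm (f z) \<le> B"
proof -
  have "bounded (f ` cball 0 R)"
    by (intro compact_imp_bounded compact_continuous_image)
      (auto intro: continuous_on_subset[OF assms(1)])
  then obtain B where B: "\<And>z. z \<in> cball 0 R \<Longrightarrow> norm (f z) \<le> B"
    unfolding bounded_iff by (meson image_eqI)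
  have "norm (f z) \<le> max B 0" for z
    by (cases "norm z \<le> R") (use B[of z] assms(2)[of z] in auto)
  then show ?thesis using that[of "max B 0"] by auto
qed

lemma onorm_inner_le:
  fixes v :: "'a::euclidean_space"
  assumes "norm v \<le> B"
  shows "onorm (\<lambda>h. h \<bullet> v) \<le> B"
proof (rule onorm_le)
  fix h
  have "norm (h \<bullet> v) \<le> norm h * norm v" by (simp add: Cauchy_Schwarz_ineq2)
  also have "\<dots> \<le> norm h * B" by (intro mult_left_mono assms) auto
  finally show "norm (h \<bullet> v) \<le> B * norm h" by (simp add: mult.commute)
qed

definition convolution :: "('a::euclidean_space \<Rightarrow> real) \<Rightarrow> ('a \<Rightarrow> real) \<Rightarrow> 'a \<Rightarrow> real" where
  "convolution H \<kappa> x = (\<integral>y. H y * \<kappa> (x - y) \<partial>lborel)"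

lemma integrable_convolution:
  fixes H :: "'a::euclidean_space \<Rightarrow> real" and \<kappa> :: "'a \<Rightarrow> 'b::{banach,second_countable_topology}"
  assumes "integrable lborel H" "continuous_on UNIV \<kappa>" "\<And>z. norm (\<kappa> z) \<le> B"
  shows "integrable lborel (\<lambda>y. H y *\<^sub>R \<kappa> (x - y))"
proof (rule Bochner_Integration.integrable_bound)
  show "integrable lborel (\<lambda>y. B * H y)" using assms by simp
  have "\<kappa> \<in> borel_measurable borel"
    using assms(2) by (rule borel_measurable_continuous_onI)
  then show "(\<lambda>y. H y *\<^sub>R \<kappa> (x - y)) \<in> borel_measurable lborel"
    using assms(1) by measurable
  have "norm (H y *\<^sub>R \<kappa> (x - y)) \<le> norm (B * H y)" for y
  proof -
    have "norm (H y *\<^sub>R \<kappa> (x - y)) \<le> \<bar>B\<bar> * \<bar>H y\<bar>"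
      using assms(3)[of "x - y"] by (auto simp: mult.commute[of "\<bar>H y\<bar>"] intro!: mult_right_mono)
    also have "\<dots> \<le> norm (B * H y)" by (simp add: abs_mult)
    finally show ?thesis .
  qed
  then show "AE y in lborel. norm (H y *\<^sub>R \<kappa> (x - y)) \<le> norm (B * H y)" by simp
qed

text \<open>Only the kernel moves with the point, so its continuity gives pointwise convergence and
  its bound gives the dominating function \<open>B * \<bar>H y\<bar>\<close>.\<close>

lemma continuous_on_convolution:
  fixes H :: "'a::euclidean_space \<Rightarrow> real"
  assumes "integrable lborel H" "continuous_on UNIV \<kappa>" "\<And>z. \<bar>\<kappa> z\<bar> \<le> B"
  shows "continuous_on A (convolution H \<kappa>)"
  unfolding continuous_on_sequentially comp_def
proof (intro allI ballI impI, elim conjE)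
  fix X :: "nat \<Rightarrow> 'a" and x assume X: "X \<longlonglongrightarrow> x"
  have int: "integrable lborel (\<lambda>y. H y * \<kappa> (x - y))" for x
    using integrable_convolution[of H \<kappa> B] assms by simp
  show "(\<lambda>n. convolution H \<kappa> (X n)) \<longlonglongrightarrow> convolution H \<kappa> x"
    unfolding convolution_def
  proof (rule integral_dominated_convergence)
    show "integrable lborel (\<lambda>y. B * \<bar>H y\<bar>)" using assms by simp
    have "isCont \<kappa> z" for z
      using assms(2) by (simp add: continuous_on_eq_continuous_at)
    then have "(\<lambda>n. H y * \<kappa> (X n - y)) \<longlonglongrightarrow> H y * \<kappa> (x - y)" for y
      by (intro tendsto_mult tendsto_const isCont_tendsto_compose[where g = \<kappa>] tendsto_diff X) auto
    then show "AE y in lborel. (\<lambda>n. H y * \<kappa> (X n - y)) \<longlonglongrightarrow> H y * \<kappa> (x - y)" by simp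
    show "AE y in lborel. norm (H y * \<kappa> (X n - y)) \<le> B * \<bar>H y\<bar>" for n
      using assms(3) by (auto intro!: AE_I2 simp: abs_mult mult.commute[of B] mult_left_mono)
  qed (use int in auto)
qed

text \<open>The derivative falls on the kernel. \<open>G\<close> is continuous with bounded support,
  hence bounded, which makes \<open>\<kappa>\<close> Lipschitz and supplies the dominating function.
  The gradient is kept as one vector-valued integral and yields all partial derivatives at
  once.\<close>

lemma has_derivative_convolution:
  assumes H: "integrable lborel H"
    and \<kappa>: "\<And>z. (\<kappa> has_derivative (\<lambda>h. h \<bullet> G z)) (at z)" "\<And>z. R \<le> norm z \<Longrightarrow> \<kappa> z = 0"
    and G: "continuous_on UNIV G" "\<And>z. R \<le> norm z \<Longrightarrow> G z = 0"
  shows "(convolution H \<kappa> has_derivative (\<lambda>h. h \<bullet> (\<integral>y. H y *\<^sub>R G (x - y) \<partial>lborel))) (at x)"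
proof -
  have cont: "continuous_on UNIV \<kappa>"
    using \<kappa>(1) by (intro has_derivative_continuous_on) (auto intro: has_derivative_at_withinI)
  obtain B where B: "B \<ge> 0" "\<And>z. norm (G z) \<le> B"
    using continuous_compact_support_bounded[OF G] by metis
  obtain C where C: "\<And>z. norm (\<kappa> z) \<le> C"
    using continuous_compact_support_bounded[OF cont \<kappa>(2)] by metis
  show ?thesis
    unfolding convolution_def[abs_def]
  proof (rule has_derivative_integral_dominated[where U = UNIV and L = "\<lambda>y. B * \<bar>H y\<bar>"])
    show "integrable lborel (\<lambda>y. H y * \<kappa> (x - y))" for x
      using integrable_convolution[OF H cont C] by simp
    show "integrable lborel (\<lambda>y. H y *\<^sub>R G (x - y))"
      using integrable_convolution[OF H G(1) B(2)] .
    show "integrable lborel (\<lambda>y. B * \<bar>H y\<bar>)" using H by simp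
    show "AE y in lborel. ((\<lambda>x. H y * \<kappa> (x - y)) has_derivative (\<lambda>h. h \<bullet> (H y *\<^sub>R G (x - y)))) (at x)"
    proof (rule AE_I2)
      fix y
      have "((\<lambda>x. x - y) has_derivative (\<lambda>h. h)) (at x)"
        by (auto intro!: derivative_eq_intros)
      from diff_chain_at[OF this \<kappa>(1)]
      show "((\<lambda>x. H y * \<kappa> (x - y)) has_derivative (\<lambda>h. h \<bullet> (H y *\<^sub>R G (x - y)))) (at x)"
        by (auto simp: comp_def intro!: derivative_eq_intros)
    qed
    fix x' y
    have "norm (\<kappa> (x' - y) - \<kappa> (x - y)) \<le> B * norm ((x' - y) - (x - y))"
    proof (rule differentiable_bound[of UNIV])
      show "onorm (\<lambda>h. h \<bullet> G z) \<le> B" for z by (rule onorm_inner_le) (rule B)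
    qed (use \<kappa>(1) in auto)
    then have "\<bar>H y\<bar> * \<bar>\<kappa> (x' - y) - \<kappa> (x - y)\<bar> \<le> \<bar>H y\<bar> * (B * norm (x' - x))"
      by (intro mult_left_mono) auto
    then show "\<bar>H y * \<kappa> (x' - y) - H y * \<kappa> (x - y)\<bar> \<le> B * \<bar>H y\<bar> * norm (x' - x)"
      by (simp add: abs_mult mult_ac flip: right_diff_distrib)
  qed auto
qed

text \<open>On the concentric ball of half the radius, which has positive measure, the kernel is
  bounded below by a positive constant.\<close>

lemma integral_bump_pos:
  fixes x :: "'a::euclidean_space"
  assumes "R > 0"
  shows "(\<integral>y. bump k R (x - y) \<partial>lborel) > 0"
proof -
  define S where "S = ball x (R / 2)"
  have int: "integrable lborel (\<lambda>y. bump k R (x - y))"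
    by (rule integrable_bounded_support[where B = "(R\<^sup>2) ^ k" and S = "cball x R"])
      (use assms in \<open>auto simp: bump_nonneg bump_le dist_norm intro!: bump_outside\<close>)
  have intS: "integrable lborel (indicator S :: 'a \<Rightarrow> real)"
    using emeasure_bounded_finite[of S] by (simp add: S_def integrable_indicator_iff)
  have "0 < (R\<^sup>2 - (R/2)\<^sup>2) ^ k * measure lborel S"
    using assms content_ball_pos[of "R / 2" x] by (auto simp: S_def power2_eq_square measure_completion)
  also have "\<dots> = (\<integral>y. (R\<^sup>2 - (R/2)\<^sup>2) ^ k * indicator S y \<partial>lborel)"
    by (simp add: S_def)
  also have "\<dots> \<le> (\<integral>y. bump k R (x - y) \<partial>lborel)"
  proof (rule integral_mono)
    fix y
    show "(R\<^sup>2 - (R/2)\<^sup>2) ^ k * indicator S y \<le> bump k R (x - y)"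
    proof (cases "y \<in> S")
      case True
      then have *: "norm (x - y) < R / 2" by (simp add: S_def dist_norm)
      then have "norm (x - y) < R" using assms by simp
      moreover have "(norm (x - y))\<^sup>2 \<le> (R / 2)\<^sup>2"
        using * by (intro power_mono) auto
      ultimately show ?thesis using True assms
        by (auto simp: bump_inside power2_eq_square intro!: power_mono)
    qed (simp add: bump_nonneg)
  qed (use int intS in auto)
  finally show ?thesis .
qed

subsection \<open>Integration by parts on balls\<close>

text \<open>The kernel vanishes off the open ball, so \<open>F\<close> may be replaced by its
  extension by zero from the closed ball, which is integrable by compactness.\<close>

lemma integrable_bump_times:
  fixes F :: "'a::euclidean_space \<Rightarrow> real"
  assumes "continuous_on (cball x R) F" "0 \<le> R"
  shows "integrable lborel (\<lambda>y. bump k R (x - y) * F y)"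
proof -
  have "integrable lborel (\<lambda>y. indicator (cball x R) y *\<^sub>R F y)"
    by (rule borel_integrable_compact) (use assms in auto)
  from integrable_times_bump[OF this, of k R x]
  have "integrable lborel (\<lambda>y. indicator (cball x R) y * F y * bump k R (x - y))" by simp
  also have "(\<lambda>y. indicator (cball x R) y * F y * bump k R (x - y)) = (\<lambda>y. bump k R (x - y) * F y)"
  proof
    show "indicator (cball x R) y * F y * bump k R (x - y) = bump k R (x - y) * F y" for y
      using bump_outside[of R "x - y" k] assms(2)
      by (cases "y \<in> cball x R") (auto simp: dist_norm)
  qed
  finally show ?thesis .
qed

text \<open>Off the sphere the integrand is the derivative in direction \<open>e\<close> of
  \<open>bump 1 R (x - y) * F y\<close>. This product vanishes outside the ball, so there is no
  boundary term, and it is Lipschitz on the whole space although \<open>F\<close> is controlled only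
  on the closed ball.\<close>

lemma integral_bump_by_parts:
  fixes F :: "'a::euclidean_space \<Rightarrow> real"
  assumes F: "\<And>y. y \<in> cball x R \<Longrightarrow> (F has_derivative (\<lambda>h. h \<bullet> G y)) (at y)"
    and G: "continuous_on (cball x R) G" and R: "0 < R"
  shows "(\<integral>y. bump 1 R (x - y) * (G y \<bullet> e) - bump 0 R (x - y) * (2 * ((y - x) \<bullet> e) * F y) \<partial>lborel) = 0"
proof -
  define q where "q y = R\<^sup>2 - (norm (x - y))\<^sup>2" for y
  have contF: "continuous_on (cball x R) F"
    using F by (intro has_derivative_continuous_on) (auto intro: has_derivative_at_withinI)
  define V where "V y = bump 1 R (x - y) * F y" for y
  have V_in: "V y = q y * F y" if "y \<in> cball x R" for y
    using that R by (cases "norm (x - y) = R") (auto simp: V_def q_def bump_inside bump_outside dist_norm)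
  have V_out: "V y = 0" if "y \<notin> cball x R" for y
    using that R by (simp add: V_def bump_outside dist_norm)
  have intV: "integrable lborel V"
    unfolding V_def[abs_def] using contF R by (intro integrable_bump_times) auto
  have intW: "integrable lborel (\<lambda>y. bump 1 R (x - y) * (G y \<bullet> e) - bump 0 R (x - y) * (2 * ((y - x) \<bullet> e) * F y))"
    using R by (intro Bochner_Integration.integrable_diff integrable_bump_times continuous_intros contF G) auto
  have q: "(q has_derivative (\<lambda>h. - 2 * (h \<bullet> (y - x)))) (at y)" for y
    unfolding q_def[abs_def] power2_norm_eq_inner
    by (rule derivative_eq_intros refl)+ (simp add: fun_eq_iff inner_commute algebra_simps)
  define GV where "GV y = q y *\<^sub>R G y - (2 * F y) *\<^sub>R (y - x)" for y
  have qF: "((\<lambda>y. q y * F y) has_derivative (\<lambda>h. h \<bullet> GV y)) (at y)" if "y \<in> cball x R" for y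
    by (rule has_derivative_eq_rhs[OF has_derivative_mult[OF q F[OF that]]])
      (simp add: fun_eq_iff GV_def algebra_simps inner_diff_right)
  have "continuous_on (cball x R) GV"
    unfolding GV_def q_def by (intro continuous_intros contF G)
  then have "bounded (GV ` cball x R)" "bounded (F ` cball x R)"
    using contF by (auto intro!: compact_imp_bounded compact_continuous_image)
  then obtain B M where B: "\<And>y. y \<in> cball x R \<Longrightarrow> norm (GV y) \<le> B"
    and M: "\<And>y. y \<in> cball x R \<Longrightarrow> norm (F y) \<le> M"
    unfolding bounded_iff by (meson image_eqI)
  have B0: "B \<ge> 0" and M0: "M \<ge> 0"
    using B[of x] M[of x] R norm_ge_zero[of "GV x"] norm_ge_zero[of "F x"] by (simp_all del: norm_ge_zero)
  \<comment> \<open>\<open>B\<close> serves two points of the ball, by the mean value inequality on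
    a convex set. \<open>2 * R * M\<close> serves a pair separated by the sphere: there
    \<open>q\<close> factors into \<open>R + norm (x - y) \<le> 2 * R\<close> and
    \<open>R - norm (x - y)\<close>, and the latter is at most the distance of the pair.\<close>
  define L where "L = max B (2 * R * M)"
  have lip_out: "\<bar>V y\<bar> \<le> L * dist y y'" if "y \<in> cball x R" "y' \<notin> cball x R" for y y'
  proof -
    have d: "norm (x - y) \<le> R" "R - norm (x - y) \<le> dist y y'"
      using that dist_triangle[of x y' y] by (auto simp: dist_norm)
    have "\<bar>V y\<bar> = (R + norm (x - y)) * (R - norm (x - y)) * \<bar>F y\<bar>"
    proof -
      have "V y = (R + norm (x - y)) * (R - norm (x - y)) * F y"
        using V_in[OF that(1)] by (simp add: q_def power2_eq_square algebra_simps)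
      then show ?thesis using d R by (simp add: abs_mult)
    qed
    also have "\<dots> \<le> (2 * R) * dist y y' * M"
      using d R M[OF that(1)] by (intro mult_mono) auto
    also have "\<dots> \<le> L * dist y y'"
    proof -
      have "2 * R * M * dist y y' \<le> L * dist y y'"
        by (intro mult_right_mono) (auto simp: L_def)
      then show ?thesis by (simp add: mult_ac)
    qed
    finally show ?thesis .
  qed
  have lip: "\<bar>V y' - V y\<bar> \<le> L * dist y y'" for y y'
  proof (cases "y \<in> cball x R"; cases "y' \<in> cball x R")
    assume y: "y \<in> cball x R" "y' \<in> cball x R"
    have "norm (q y' * F y' - q y * F y) \<le> B * norm (y' - y)"
      by (rule differentiable_bound[OF convex_cball has_derivative_at_withinI[OF qF] onorm_inner_le[OF B]])
        (use y in auto)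
    also have "\<dots> \<le> L * dist y y'"
      by (simp add: L_def dist_norm norm_minus_commute mult_right_mono)
    finally show ?thesis using V_in y by simp
  next
    assume "y \<in> cball x R" "y' \<notin> cball x R"
    then show ?thesis using V_out lip_out by simp
  next
    assume "y \<notin> cball x R" "y' \<in> cball x R"
    then show ?thesis using V_out lip_out[of y' y] by (simp add: dist_commute)
  next
    assume "y \<notin> cball x R" "y' \<notin> cball x R"
    then show ?thesis using V_out B0 by (simp add: L_def)
  qed
  have der: "AE y in lborel. ((\<lambda>t. V (y + t *\<^sub>R e)) has_real_derivative
      bump 1 R (x - y) * (G y \<bullet> e) - bump 0 R (x - y) * (2 * ((y - x) \<bullet> e) * F y)) (at 0)"
    using AE_not_sphere[of x R]
  proof eventually_elim
    case (elim y)
    \<comment> \<open>One formula for the gradient on both sides of the sphere: inside,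
      \<open>bump 1\<close> is \<open>q\<close> and \<open>bump 0\<close> is \<open>1\<close>;
      outside, both vanish.\<close>
    define D where "D = bump 1 R (x - y) *\<^sub>R G y - (bump 0 R (x - y) * (2 * F y)) *\<^sub>R (y - x)"
    have "(V has_derivative (\<lambda>h. h \<bullet> D)) (at y)"
    proof (cases "y \<in> ball x R")
      case True
      then have "norm (x - y) < R" by (simp add: dist_norm)
      then have "D = GV y" by (simp add: D_def GV_def q_def bump_inside)
      then show ?thesis
        using has_derivative_transform_within_open[OF qF[of y], of "ball x R" V] True V_in by auto
    next
      case False
      then have y: "y \<in> - cball x R" using elim by (simp add: dist_norm)
      then have "R < norm (x - y)" by (simp add: dist_norm)
      then have "D = 0" using R by (simp add: D_def bump_outside)
      moreover have "(V has_derivative (\<lambda>h. 0)) (at y)"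
        by (rule has_derivative_transform_within_open[OF has_derivative_const _ y]) (use V_out in auto)
      ultimately show ?thesis by simp
    qed
    then have VD: "(V has_derivative (\<lambda>h. h \<bullet> D)) (at (y + 0 *\<^sub>R e))" by simp
    have "((\<lambda>t. y + t *\<^sub>R e) has_derivative (\<lambda>t. t *\<^sub>R e)) (at 0)"
      by (auto intro!: derivative_eq_intros)
    from diff_chain_at[OF this VD] show ?case
      by (auto simp: has_field_derivative_def comp_def D_def fun_eq_iff inner_diff_left inner_commute algebra_simps
          elim!: has_derivative_eq_rhs)
  qed
  show ?thesis
    by (rule integral_directional_derivative_eq_0[OF intV intW V_out lip der])
qed

text \<open>\<open>H i\<close> is the gradient of the partial derivative of \<open>f\<close> in direction \<open>i\<close>.\<close>

definition has_gradient_hessian ::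
  "('a::euclidean_space \<Rightarrow> real) \<Rightarrow> ('a \<Rightarrow> 'a) \<Rightarrow> ('a \<Rightarrow> 'a \<Rightarrow> 'a) \<Rightarrow> 'a set \<Rightarrow> bool" where
  "has_gradient_hessian f g H S \<longleftrightarrow>
     (\<forall>y\<in>S. (f has_derivative (\<lambda>h. h \<bullet> g y)) (at y)) \<and>
     (\<forall>i\<in>Basis. \<forall>y\<in>S. ((\<lambda>y. g y \<bullet> i) has_derivative (\<lambda>h. h \<bullet> H i y)) (at y)) \<and>
     (\<forall>i\<in>Basis. continuous_on S (H i))"

lemma has_gradient_hessian_subset:
  "has_gradient_hessian f g H S \<Longrightarrow> T \<subseteq> S \<Longrightarrow> has_gradient_hessian f g H T"
  unfolding has_gradient_hessian_def by (meson continuous_on_subset subsetD)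

lemma has_gradient_hessian_diff_const:
  "has_gradient_hessian f g H S \<Longrightarrow> has_gradient_hessian (\<lambda>y. f y - c) g H S"
  unfolding has_gradient_hessian_def by (auto intro!: derivative_eq_intros)

lemma has_gradient_hessian_continuous_on:
  assumes "has_gradient_hessian f g H S"
  shows "continuous_on S f" "continuous_on S g"
proof -
  show "continuous_on S f"
    using assms unfolding has_gradient_hessian_def
    by (intro has_derivative_continuous_on) (auto intro: has_derivative_at_withinI)
  have "continuous_on S (\<lambda>y. g y \<bullet> i)" if "i \<in> Basis" for i
    using assms that unfolding has_gradient_hessian_def
    by (intro has_derivative_continuous_on) (auto intro: has_derivative_at_withinI)
  then show "continuous_on S g"
    using continuous_on_componentwise[of S g] by blast
qed

text \<open>
  The divergence theorem for the field \<open>q\<^sup>2 * \<nabla>f + 4 * q * f * (y - x)\<close> with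
  \<open>q = R\<^sup>2 - \<bar>y - x\<bar>\<^sup>2\<close>, which vanishes on the sphere; its divergence is
  \<open>q\<^sup>2 * \<Delta>f + (4 * N + 8) * q * f - 8 * R\<^sup>2 * f\<close>.
\<close>

lemma integral_bump_laplacian:
  fixes f :: "'a::euclidean_space \<Rightarrow> real"
  assumes f: "has_gradient_hessian f g H (cball x R)" and R: "0 < R"
  shows "(\<integral>y. bump 2 R (x - y) * (\<Sum>i\<in>Basis. H i y \<bullet> i) \<partial>lborel)
    = 8 * R\<^sup>2 * (\<integral>y. bump 0 R (x - y) * f y \<partial>lborel)
      - (4 * real DIM('a) + 8) * (\<integral>y. bump 1 R (x - y) * f y \<partial>lborel)"
proof -
  note cont = has_gradient_hessian_continuous_on[OF f]
  have contH: "continuous_on (cball x R) (H i)" if "i \<in> Basis" for i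
    using f that unfolding has_gradient_hessian_def by blast
  \<comment> \<open>\<open>F i\<close> is the component of the field in direction \<open>i\<close>
    with one factor \<open>q\<close> removed; integration by parts against \<open>bump 1\<close>
    restores that factor.\<close>
  define F where "F i y = (R\<^sup>2 - (norm (x - y))\<^sup>2) * (g y \<bullet> i) + 4 * ((y - x) \<bullet> i) * f y" for i y
  define G where "G i y = (R\<^sup>2 - (norm (x - y))\<^sup>2) *\<^sub>R H i y - (2 * (g y \<bullet> i)) *\<^sub>R (y - x)
     + (4 * f y) *\<^sub>R i + (4 * ((y - x) \<bullet> i)) *\<^sub>R g y" for i y
  define I where "I i y = bump 1 R (x - y) * (G i y \<bullet> i) - bump 0 R (x - y) * (2 * ((y - x) \<bullet> i) * F i y)" for i y
  have FG: "(F i has_derivative (\<lambda>h. h \<bullet> G i y)) (at y)" if "i \<in> Basis" "y \<in> cball x R" for i y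
  proof -
    have "(f has_derivative (\<lambda>h. h \<bullet> g y)) (at y)" "((\<lambda>y. g y \<bullet> i) has_derivative (\<lambda>h. h \<bullet> H i y)) (at y)"
      using f that unfolding has_gradient_hessian_def by auto
    moreover define p where "p = (\<lambda>y. g y \<bullet> i)"
    ultimately have fp: "(f has_derivative (\<lambda>h. h \<bullet> g y)) (at y)" "(p has_derivative (\<lambda>h. h \<bullet> H i y)) (at y)"
      by auto
    have "F i = (\<lambda>y. (R\<^sup>2 - (x - y) \<bullet> (x - y)) * p y + 4 * ((y - x) \<bullet> i) * f y)"
      by (simp add: F_def p_def fun_eq_iff power2_norm_eq_inner)
    moreover have "(\<dots> has_derivative (\<lambda>h. h \<bullet> G i y)) (at y)"
      by (rule derivative_eq_intros fp refl)+
        (simp add: fun_eq_iff G_def p_def power2_norm_eq_inner inner_commute algebra_simps)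
    ultimately show ?thesis by simp
  qed
  have contG: "continuous_on (cball x R) (G i)" if "i \<in> Basis" for i
    unfolding G_def by (intro continuous_intros cont contH that)
  have contF: "continuous_on (cball x R) (F i)" for i
    unfolding F_def by (intro continuous_intros cont)
  have I0: "(\<integral>y. I i y \<partial>lborel) = 0" if "i \<in> Basis" for i
    unfolding I_def using FG contG R that by (intro integral_bump_by_parts) auto
  have intI: "integrable lborel (I i)" if "i \<in> Basis" for i
    unfolding I_def[abs_def] using R that
    by (intro Bochner_Integration.integrable_diff integrable_bump_times continuous_intros contF contG) auto
  \<comment> \<open>The terms containing \<open>g y \<bullet> i\<close> cancel. This is what fixes
    the coefficient \<open>4\<close> in the field.\<close>
  have I_eq: "I i y = bump 2 R (x - y) * (H i y \<bullet> i) + 4 * (bump 1 R (x - y) * f y)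
      - 8 * (bump 0 R (x - y) * f y) * ((x - y) \<bullet> i)\<^sup>2" if i: "i \<in> Basis" for i y
  proof -
    define Q where "Q = R\<^sup>2 - (norm (x - y))\<^sup>2"
    have b: "bump 1 R (x - y) = Q * bump 0 R (x - y)" "bump 2 R (x - y) = Q * (Q * bump 0 R (x - y))"
      using bump_mult[of R "x - y" 1] bump_mult[of R "x - y" 0] by (simp_all add: Q_def numeral_2_eq_2)
    show ?thesis
      unfolding I_def G_def F_def b Q_def[symmetric]
      by (simp add: inner_add_left inner_diff_left i power2_eq_square algebra_simps)
  qed
  \<comment> \<open>The squares in \<open>I_eq\<close> add up to
    \<open>(norm (x - y))\<^sup>2\<close>, which is \<open>R\<^sup>2\<close> minus \<open>q\<close>.
    The part with \<open>q\<close> turns \<open>bump 0\<close> into \<open>bump 1\<close> and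
    contributes the \<open>8\<close> in \<open>4 * N + 8\<close>.\<close>
  have "(\<Sum>i\<in>Basis. I i y) = bump 2 R (x - y) * (\<Sum>i\<in>Basis. H i y \<bullet> i)
      + (4 * real DIM('a) + 8) * (bump 1 R (x - y) * f y) - 8 * R\<^sup>2 * (bump 0 R (x - y) * f y)" for y
  proof -
    have n: "(\<Sum>i\<in>Basis. ((x - y) \<bullet> i)\<^sup>2) = (norm (x - y))\<^sup>2"
      unfolding power2_norm_eq_inner by (subst euclidean_inner) (simp add: power2_eq_square)
    have "(\<Sum>i\<in>Basis. I i y) = bump 2 R (x - y) * (\<Sum>i\<in>Basis. H i y \<bullet> i)
        + real DIM('a) * (4 * (bump 1 R (x - y) * f y)) - 8 * (bump 0 R (x - y) * f y) * (norm (x - y))\<^sup>2"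
      by (simp add: I_eq sum.distrib sum_subtractf sum_distrib_left flip: n)
    moreover have "(R\<^sup>2 - (norm (x - y))\<^sup>2) * bump 0 R (x - y) = bump 1 R (x - y)"
      using bump_mult[of R "x - y" 0] by simp
    ultimately show ?thesis by algebra
  qed
  moreover have "(\<integral>y. (\<Sum>i\<in>Basis. I i y) \<partial>lborel) = 0"
    using I0 intI by (simp add: Bochner_Integration.integral_sum)
  ultimately have "(\<integral>y. bump 2 R (x - y) * (\<Sum>i\<in>Basis. H i y \<bullet> i)
      + (4 * real DIM('a) + 8) * (bump 1 R (x - y) * f y) - 8 * R\<^sup>2 * (bump 0 R (x - y) * f y) \<partial>lborel) = 0"
    by simp
  moreover have "integrable lborel (\<lambda>y. bump 2 R (x - y) * (\<Sum>i\<in>Basis. H i y \<bullet> i))"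
    using R by (intro integrable_bump_times continuous_intros contH) auto
  moreover have "integrable lborel (\<lambda>y. bump k R (x - y) * f y)" for k
    using R cont by (intro integrable_bump_times) auto
  ultimately show ?thesis by simp
qed

subsection \<open>Harmonicity and the mean value property\<close>

text \<open>The kernel is nonnegative and vanishes off the open ball. The estimate turns continuity
  at the centre into smallness relative to the mass of the kernel, which is the form used whenever
  balls shrink to a point.\<close>

lemma abs_integral_bump_le:
  fixes h :: "'a::euclidean_space \<Rightarrow> real"
  assumes h: "continuous_on (cball x R) h" and R: "0 \<le> R" and le: "\<And>y. y \<in> ball x R \<Longrightarrow> \<bar>h y\<bar> \<le> \<epsilon>"
  shows "\<bar>\<integral>y. bump k R (x - y) * h y \<partial>lborel\<bar> \<le> \<epsilon> * (\<integral>y. bump k R (x - y) \<partial>lborel)"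
proof -
  have int: "integrable lborel (\<lambda>y. bump k R (x - y) * h y)" "integrable lborel (\<lambda>y. bump k R (x - y))"
    using integrable_bump_times[OF h R, of k] integrable_bump_times[of x R "\<lambda>_. 1" k] R by auto
  have "\<bar>\<integral>y. bump k R (x - y) * h y \<partial>lborel\<bar> \<le> (\<integral>y. \<bar>bump k R (x - y) * h y\<bar> \<partial>lborel)"
    using integral_norm_bound[of lborel "\<lambda>y. bump k R (x - y) * h y"] by simp
  also have "\<dots> \<le> (\<integral>y. \<epsilon> * bump k R (x - y) \<partial>lborel)"
  proof (rule integral_mono)
    fix y
    show "\<bar>bump k R (x - y) * h y\<bar> \<le> \<epsilon> * bump k R (x - y)"
    proof (cases "y \<in> ball x R")
      case True
      then show ?thesis using le[OF True]
        by (simp add: abs_mult bump_nonneg mult.commute[of \<epsilon>] mult_left_mono)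
    next
      case False
      then show ?thesis using R by (simp add: bump_outside dist_norm)
    qed
  qed (use int in auto)
  finally show ?thesis by simp
qed

lemma integral_bump_0:
  "0 \<le> R \<Longrightarrow> (\<integral>y. bump 0 R (x - y) * f y \<partial>lborel) = (\<integral>y. indicator (ball x R) y * f y \<partial>lborel)"
  by (simp add: bump_0 indicator_def dist_norm norm_minus_commute)

text \<open>Bounding the kernel by \<open>R\<^sup>2\<close> on the ball already gives the order
  \<open>R ^ (N + 2)\<close>, the power against which this integral is compared.\<close>

lemma integral_bump_1_le:
  fixes x :: "'a::euclidean_space"
  assumes "0 < R"
  shows "(\<integral>y. bump 1 R (x - y) \<partial>lborel) \<le> R\<^sup>2 * (unit_ball_vol DIM('a) * R ^ DIM('a))"
proof -
  have intS: "integrable lborel (indicator (ball x R) :: 'a \<Rightarrow> real)"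
    using emeasure_bounded_finite[of "ball x R"] by (simp add: integrable_indicator_iff)
  have "(\<integral>y. bump 1 R (x - y) \<partial>lborel) \<le> (\<integral>y. R\<^sup>2 * indicator (ball x R) y \<partial>lborel)"
  proof (rule integral_mono)
    show "integrable lborel (\<lambda>y. bump 1 R (x - y))"
      using integrable_bump_times[of x R "\<lambda>_. 1" 1] assms by auto
    show "bump 1 R (x - y) \<le> R\<^sup>2 * indicator (ball x R) y" for y
      using bump_le[of 1 R "x - y"] assms by (cases "y \<in> ball x R") (auto simp: bump_outside dist_norm)
  qed (use intS in simp)
  also have "\<dots> = R\<^sup>2 * (unit_ball_vol DIM('a) * R ^ DIM('a))"
    using content_ball[of R x] assms by (simp add: measure_completion)
  finally show ?thesis .
qed

text \<open>As \<open>h\<close> is controlled only on \<open>cball x r\<close>, it is extended by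
  zero. The integrals are unchanged exactly for the radii in \<open>{0..r}\<close> considered here,
  whence the derivative within that interval.\<close>

lemma DERIV_integral_bump_continuous:
  fixes h :: "'a::euclidean_space \<Rightarrow> real"
  assumes h: "continuous_on (cball x r) h" and R: "0 \<le> R" "R \<le> r"
  shows "((\<lambda>R. \<integral>y. bump (Suc k) R (x - y) * h y \<partial>lborel) has_real_derivative
      2 * real (Suc k) * R * (\<integral>y. bump k R (x - y) * h y \<partial>lborel)) (at R within {0..r})"
proof -
  define H where "H y = indicator (cball x r) y * h y" for y
  have "integrable lborel (\<lambda>y. indicator (cball x r) y *\<^sub>R h y)"
    by (rule borel_integrable_compact) (use h in auto)
  then have H: "integrable lborel H" by (simp add: H_def[abs_def])
  have eq: "(\<integral>y. H y * bump k R (x - y) \<partial>lborel) = (\<integral>y. bump k R (x - y) * h y \<partial>lborel)"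
    if "0 \<le> R" "R \<le> r" for k R
  proof (rule Bochner_Integration.integral_cong)
    show "H y * bump k R (x - y) = bump k R (x - y) * h y" for y
      using that by (cases "y \<in> cball x r") (auto simp: H_def bump_outside dist_norm)
  qed simp
  show ?thesis
    unfolding eq[OF R, symmetric]
  proof (rule has_field_derivative_transform_within)
    show "((\<lambda>R. \<integral>y. H y * bump (Suc k) R (x - y) \<partial>lborel) has_real_derivative
        2 * real (Suc k) * R * (\<integral>y. H y * bump k R (x - y) \<partial>lborel)) (at R within {0..r})"
      using DERIV_integral_bump[OF H] by (rule has_field_derivative_at_within)
    show "0 < (1::real)" "R \<in> {0..r}" using R by auto
    fix R' assume "R' \<in> {0..r}"
    then have "0 \<le> R'" "R' \<le> r" by auto
    then show "(\<integral>y. H y * bump (Suc k) R' (x - y) \<partial>lborel) = (\<integral>y. bump (Suc k) R' (x - y) * h y \<partial>lborel)"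
      by (rule eq)
  qed
qed

text \<open>By induction on \<open>k\<close>: the integral for \<open>Suc k\<close> is
  \<open>0\<close> at radius \<open>0\<close>, and its derivative is a multiple of the radius times
  the integral for \<open>k\<close>. At radius \<open>0\<close> that factor makes the derivative
  vanish; elsewhere the induction hypothesis does.\<close>

lemma mean_value_bump:
  fixes h :: "'a::euclidean_space \<Rightarrow> real"
  assumes h: "continuous_on (cball x r) h"
    and 0: "\<And>R. 0 < R \<Longrightarrow> R < r \<Longrightarrow> (\<integral>y. bump 0 R (x - y) * h y \<partial>lborel) = 0"
    and R: "0 < R" "R < r"
  shows "(\<integral>y. bump k R (x - y) * h y \<partial>lborel) = 0"
  using R
proof (induction k arbitrary: R)
  case (Suc k)
  define J where "J R = (\<integral>y. bump (Suc k) R (x - y) * h y \<partial>lborel)" for R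
  have "(J has_real_derivative 0) (at t within {0..<r})" if "t \<in> {0..<r}" for t
  proof -
    have "2 * real (Suc k) * t * (\<integral>y. bump k t (x - y) * h y \<partial>lborel) = 0"
      using Suc.IH[of t] that by (cases "t = 0") auto
    then have "(J has_real_derivative 0) (at t within {0..r})"
      using DERIV_cong[OF DERIV_integral_bump_continuous[OF h, of t k]] that unfolding J_def[abs_def] by auto
    then show ?thesis by (rule DERIV_subset) auto
  qed
  then have "\<exists>c. \<forall>t\<in>{0..<r}. J t = c"
    by (intro has_field_derivative_zero_constant) auto
  then have "J R = J 0" using Suc.prems by auto
  also have "J 0 = 0" by (simp add: J_def bump_outside)
  finally show ?case by (simp add: J_def)
qed (use 0 in auto)

text \<open>
  For harmonic \<open>f\<close> the relations between \<open>J 0\<close> and \<open>J 1\<close> make \<open>J 1 R / R ^ (N + 2)\<close> constant, and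
  continuity of \<open>f\<close> at \<open>x\<close> makes it tend to \<open>0\<close> with \<open>R\<close>.
\<close>

lemma harmonic_mean_value:
  fixes f :: "'a::euclidean_space \<Rightarrow> real"
  assumes f: "has_gradient_hessian f g H (cball x r)" and "0 < r"
    and lap: "\<And>y. y \<in> cball x r \<Longrightarrow> (\<Sum>i\<in>Basis. H i y \<bullet> i) = 0"
  shows "(\<integral>y. indicator (ball x r) y * f y \<partial>lborel) = f x * measure lborel (ball x r)"
proof -
  define n where "n = DIM('a)"
  define h where "h y = f y - f x" for y
  have h: "has_gradient_hessian h g H (cball x r)"
    unfolding h_def using f by (rule has_gradient_hessian_diff_const)
  note conth = has_gradient_hessian_continuous_on(1)[OF h]
  define J where "J k R = (\<integral>y. bump k R (x - y) * h y \<partial>lborel)" for k R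
  have J01: "2 * R\<^sup>2 * J 0 R = (real n + 2) * J 1 R" if "0 < R" "R \<le> r" for R
  proof -
    have "has_gradient_hessian h g H (cball x R)"
      using that by (intro has_gradient_hessian_subset[OF h]) auto
    from integral_bump_laplacian[OF this \<open>0 < R\<close>]
    have "(\<integral>y. bump 2 R (x - y) * (\<Sum>i\<in>Basis. H i y \<bullet> i) \<partial>lborel)
        = 8 * R\<^sup>2 * J 0 R - (4 * real n + 8) * J 1 R"
      by (simp add: J_def n_def)
    moreover have "bump 2 R (x - y) * (\<Sum>i\<in>Basis. H i y \<bullet> i) = 0" for y
      using that lap[of y] bump_outside[of R "x - y" 2] by (cases "y \<in> cball x R") (auto simp: dist_norm)
    ultimately have "8 * R\<^sup>2 * J 0 R - (4 * real n + 8) * J 1 R = 0" by simp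
    then show ?thesis by (simp add: algebra_simps)
  qed
  \<comment> \<open>By \<open>J01\<close> the derivative \<open>2 * R * J 0 R\<close> of
    \<open>J 1\<close> equals \<open>(n + 2) * J 1 R / R\<close>, an equation solved by the
    multiples of \<open>R ^ (n + 2)\<close>. The interval contains its endpoint \<open>r\<close>,
    since the mean value is wanted for the radius \<open>r\<close> itself.\<close>
  have "((\<lambda>R. J 1 R / R ^ (n + 2)) has_real_derivative 0) (at R within {0<..r})" if "R \<in> {0<..r}" for R
  proof -
    have "(J 1 has_real_derivative 2 * R * J 0 R) (at R within {0..r})"
      using DERIV_integral_bump_continuous[OF conth, of R 0] that by (simp add: J_def[abs_def])
    then have J1: "(J 1 has_real_derivative 2 * R * J 0 R) (at R within {0<..r})"
      by (rule DERIV_subset) auto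
    have "((\<lambda>R. J 1 R / R ^ (n + 2)) has_real_derivative
        (2 * R * J 0 R * R ^ (n + 2) - J 1 R * (real (n + 2) * R ^ (n + 1))) / (R ^ (n + 2) * R ^ (n + 2))) (at R within {0<..r})"
      by (rule DERIV_divide[OF J1 DERIV_power[OF DERIV_ident, THEN DERIV_cong]]) (use that in auto)
    also have "2 * R * J 0 R * R ^ (n + 2) - J 1 R * (real (n + 2) * R ^ (n + 1))
        = R ^ (n + 1) * (2 * R\<^sup>2 * J 0 R - (real n + 2) * J 1 R)"
      by (simp add: algebra_simps power2_eq_square)
    also have "\<dots> = 0" using J01[of R] that by simp
    finally show ?thesis by simp
  qed
  then have "\<exists>c. \<forall>R\<in>{0<..r}. J 1 R / R ^ (n + 2) = c"
    by (intro has_field_derivative_zero_constant) auto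
  then obtain c where c: "\<And>R. 0 < R \<Longrightarrow> R \<le> r \<Longrightarrow> J 1 R = c * R ^ (n + 2)"
    by (auto simp: field_simps)
  \<comment> \<open>\<open>J 1 R\<close> and its bound carry the same power
    \<open>R ^ (n + 2)\<close>. It cancels, so the bound on \<open>c\<close> does not depend on how
    small \<open>R\<close> had to be chosen.\<close>
  have c_le: "\<bar>c\<bar> \<le> \<epsilon> * unit_ball_vol n" if "\<epsilon> > 0" for \<epsilon>
  proof -
    have "isCont h x"
      using conth \<open>0 < r\<close> by (intro continuous_on_interior[of "cball x r"]) auto
    then obtain d where d: "d > 0" "\<And>y. dist y x < d \<Longrightarrow> dist (h y) (h x) < \<epsilon>"
      using \<open>\<epsilon> > 0\<close> unfolding continuous_at_eps_delta by metis
    define R where "R = min (d/2) (r/2)"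
    have R: "0 < R" "R < r" "R < d" using d \<open>0 < r\<close> by (auto simp: R_def)
    have "\<bar>J 1 R\<bar> \<le> \<epsilon> * (\<integral>y. bump 1 R (x - y) \<partial>lborel)"
      unfolding J_def
    proof (rule abs_integral_bump_le)
      show "continuous_on (cball x R) h" using conth R by (auto intro: continuous_on_subset)
      show "\<bar>h y\<bar> \<le> \<epsilon>" if "y \<in> ball x R" for y
        using d(2)[of y] that R by (simp add: h_def dist_commute dist_real_def)
    qed (use R in auto)
    also have "\<dots> \<le> \<epsilon> * (R\<^sup>2 * (unit_ball_vol n * R ^ n))"
      using integral_bump_1_le[of R x] R \<open>\<epsilon> > 0\<close> by (intro mult_left_mono) (auto simp: n_def)
    finally have "\<bar>c\<bar> * R ^ (n + 2) \<le> (\<epsilon> * unit_ball_vol n) * R ^ (n + 2)"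
      unfolding c[OF R(1) less_imp_le[OF R(2)]]
      using R by (simp add: abs_mult power_add power2_eq_square algebra_simps)
    then show ?thesis using R by simp
  qed
  have "\<bar>c\<bar> \<le> 0 + e" if "e > 0" for e
  proof -
    have "unit_ball_vol n > 0" by simp
    then show ?thesis using c_le[of "e / unit_ball_vol n"] that by (simp split: if_splits)
  qed
  then have "\<bar>c\<bar> \<le> 0" by (rule field_le_epsilon)
  then have "J 1 r = 0" using c[of r] \<open>0 < r\<close> by simp
  then have "J 0 r = 0" using J01[of r] \<open>0 < r\<close> by simp
  have intS: "integrable lborel (indicator (ball x r) :: 'a \<Rightarrow> real)"
    using emeasure_bounded_finite[of "ball x r"] by (simp add: integrable_indicator_iff)
  have "integrable lborel (\<lambda>y. bump 0 r (x - y) * f y)"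
    using has_gradient_hessian_continuous_on(1)[OF f] \<open>0 < r\<close> by (intro integrable_bump_times) auto
  then have intf: "integrable lborel (\<lambda>y. indicator (ball x r) y * f y)"
    using \<open>0 < r\<close> by (simp add: bump_0 indicator_def dist_norm norm_minus_commute)
  have "0 = (\<integral>y. indicator (ball x r) y * h y \<partial>lborel)"
    using \<open>J 0 r = 0\<close> \<open>0 < r\<close> integral_bump_0[of r x h] unfolding J_def by simp
  also have "\<dots> = (\<integral>y. indicator (ball x r) y * f y - f x * indicator (ball x r) y \<partial>lborel)"
    by (simp add: h_def algebra_simps)
  finally show ?thesis using intS intf by simp
qed

text \<open>The mean value property makes the integrals of \<open>f y - f x\<close> against
  \<open>bump 0\<close> and \<open>bump 1\<close> vanish, so \<open>integral_bump_laplacian\<close>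
  leaves a vanishing integral of the Laplacian against the positive kernel \<open>bump 2\<close>. As
  the radius shrinks, continuity of the Laplacian isolates its value at \<open>x\<close>.\<close>

lemma laplacian_eq_0_if_mean_value:
  fixes f :: "'a::euclidean_space \<Rightarrow> real"
  assumes f: "has_gradient_hessian f g H (cball x r)" and "0 < r"
    and mean: "\<And>R. 0 < R \<Longrightarrow> R < r \<Longrightarrow> (\<integral>y. bump 0 R (x - y) * (f y - f x) \<partial>lborel) = 0"
  shows "(\<Sum>i\<in>Basis. H i x \<bullet> i) = 0"
proof -
  define T where "T y = (\<Sum>i\<in>Basis. H i y \<bullet> i)" for y
  have h: "has_gradient_hessian (\<lambda>y. f y - f x) g H (cball x r)"
    using f by (rule has_gradient_hessian_diff_const)
  note conth = has_gradient_hessian_continuous_on(1)[OF h]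
  have contT: "continuous_on (cball x r) T"
    using f unfolding T_def has_gradient_hessian_def by (intro continuous_intros) auto
  have "\<bar>T x\<bar> \<le> 0 + \<epsilon>" if "\<epsilon> > 0" for \<epsilon>
  proof -
    have "isCont T x"
      using contT \<open>0 < r\<close> by (intro continuous_on_interior[of "cball x r"]) auto
    then obtain d where d: "d > 0" "\<And>y. dist y x < d \<Longrightarrow> dist (T y) (T x) < \<epsilon>"
      using \<open>\<epsilon> > 0\<close> unfolding continuous_at_eps_delta by metis
    define R where "R = min (d/2) (r/2)"
    have R: "0 < R" "R < r" "R < d" using d \<open>0 < r\<close> by (auto simp: R_def)
    define C where "C = (\<integral>y. bump 2 R (x - y) \<partial>lborel)"
    have C: "C > 0" unfolding C_def using R by (intro integral_bump_pos) auto
    have contT': "continuous_on (cball x R) T"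
      using contT R by (auto intro: continuous_on_subset)
    have "has_gradient_hessian (\<lambda>y. f y - f x) g H (cball x R)"
      using R by (intro has_gradient_hessian_subset[OF h]) auto
    from integral_bump_laplacian[OF this \<open>0 < R\<close>]
    have "(\<integral>y. bump 2 R (x - y) * T y \<partial>lborel) = 0"
      using mean_value_bump[OF conth mean, of R 0] mean_value_bump[OF conth mean, of R 1] R
      by (simp add: T_def)
    moreover have "integrable lborel (\<lambda>y. bump 2 R (x - y) * T y)"
      using contT' R by (intro integrable_bump_times) auto
    moreover have "integrable lborel (\<lambda>y. bump 2 R (x - y))"
      using integrable_bump_times[of x R "\<lambda>_. 1" 2] R by auto
    ultimately have "(\<integral>y. bump 2 R (x - y) * (T y - T x) \<partial>lborel) = - (T x * C)"
      by (simp add: C_def right_diff_distrib)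
    moreover have "\<bar>\<integral>y. bump 2 R (x - y) * (T y - T x) \<partial>lborel\<bar> \<le> \<epsilon> * C"
      unfolding C_def
    proof (rule abs_integral_bump_le)
      show "continuous_on (cball x R) (\<lambda>y. T y - T x)" using contT' by (intro continuous_intros)
      show "\<bar>T y - T x\<bar> \<le> \<epsilon>" if "y \<in> ball x R" for y
        using d(2)[of y] that R by (simp add: dist_commute dist_real_def)
    qed (use R in auto)
    ultimately have "\<bar>T x\<bar> * C \<le> \<epsilon> * C" using C by (simp add: abs_mult)
    then show ?thesis using C by simp
  qed
  then have "\<bar>T x\<bar> \<le> 0" by (rule field_le_epsilon)
  then show ?thesis by (simp add: T_def)
qed

section \<open>Regularity of functions with the mean value property\<close>

lemma integral_bump_translate:
  fixes x :: "'a::euclidean_space"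
  assumes "0 \<le> R"
  shows "(\<integral>y. bump k R (x - y) \<partial>lborel) = (\<integral>y. bump k R (y::'a) \<partial>lborel)"
proof -
  have "integrable lborel (\<lambda>y::'a. bump k R (0 - y) * 1)"
    using assms by (intro integrable_bump_times) auto
  then have "integrable lborel (bump k R :: 'a \<Rightarrow> real)"
    unfolding bump_minus by simp
  from lborel_integral_translate(2)[OF this, of "- x"] show ?thesis
    unfolding bump_minus[of k R x] by simp
qed

text \<open>
  Locally \<open>f\<close> is a multiple of its convolution with the kernel for \<open>k = 3\<close>, which is twice
  continuously differentiable.
\<close>

lemma twice_differentiable_if_mean_value:
  fixes f :: "'a::euclidean_space \<Rightarrow> real"
  assumes D: "open D" "x0 \<in> D" and f: "continuous_on D f"
    and mean: "\<And>x R. 0 < R \<Longrightarrow> cball x R \<subseteq> D \<Longrightarrow> (\<integral>y. bump 0 R (x - y) * (f y - f x) \<partial>lborel) = 0"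
  obtains S g H where "open S" "x0 \<in> S" "S \<subseteq> D" "has_gradient_hessian f g H S"
proof -
  obtain r where r: "r > 0" "cball x0 r \<subseteq> D"
    using D open_contains_cball by blast
  \<comment> \<open>For \<open>x\<close> in \<open>ball x0 R\<close> the ball
    \<open>cball x (2 * R)\<close> lies in \<open>cball x0 r\<close>. The radius
    \<open>2 * R\<close> is available because \<open>mean_value_bump\<close> treats only radii
    strictly below the one on which continuity is assumed.\<close>
  define R where "R = r / 3"
  have R: "R > 0" using r by (simp add: R_def)
  define F where "F y = indicator (cball x0 r) y * f y" for y
  have "integrable lborel (\<lambda>y. indicator (cball x0 r) y *\<^sub>R f y)"
    by (rule borel_integrable_compact) (use f r in \<open>auto intro: continuous_on_subset\<close>)
  then have F: "integrable lborel F" by (simp add: F_def[abs_def])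
  define C where "C = (\<integral>y. bump 3 R (y::'a) \<partial>lborel)"
  have C: "C > 0"
    unfolding C_def using integral_bump_pos[OF R, where x = "0::'a" and k = 3] integral_bump_translate[of R 3 "0::'a"] R by simp
  have f_eq: "f x = (1 / C) * convolution F (bump 3 R) x" if "x \<in> ball x0 R" for x
  proof -
    have sub: "cball x (2 * R) \<subseteq> cball x0 r"
    proof
      fix y assume "y \<in> cball x (2 * R)"
      then show "y \<in> cball x0 r"
        using that dist_triangle[of x0 y x] by (simp add: R_def)
    qed
    have cont: "continuous_on (cball x (2 * R)) f"
      using f sub r by (auto intro: continuous_on_subset)
    have "(\<integral>y. bump 3 R (x - y) * (f y - f x) \<partial>lborel) = 0"
    proof (rule mean_value_bump[where r = "2 * R"])
      fix s assume "0 < s" "s < 2 * R"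
      then have "cball x s \<subseteq> cball x (2 * R)" by (intro subset_cball) auto
      then have "cball x s \<subseteq> D" using sub r by blast
      then show "(\<integral>y. bump 0 s (x - y) * (f y - f x) \<partial>lborel) = 0"
        using \<open>0 < s\<close> by (intro mean)
    qed (use R cont in \<open>auto intro!: continuous_intros\<close>)
    moreover have "integrable lborel (\<lambda>y. bump 3 R (x - y) * f y)"
      using R by (intro integrable_bump_times continuous_on_subset[OF cont]) auto
    moreover have "integrable lborel (\<lambda>y. bump 3 R (x - y))"
      using integrable_bump_times[of x R "\<lambda>_. 1" 3] R by auto
    ultimately have "f x * C = (\<integral>y. bump 3 R (x - y) * f y \<partial>lborel)"
      using R by (simp add: C_def right_diff_distrib integral_bump_translate)
    also have "\<dots> = convolution F (bump 3 R) x"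
      unfolding convolution_def
    proof (rule Bochner_Integration.integral_cong)
      fix y
      show "bump 3 R (x - y) * f y = F y * bump 3 R (x - y)"
      proof (cases "y \<in> cball x R")
        case True
        then have "y \<in> cball x (2 * R)" using R by simp
        then have "y \<in> cball x0 r" using sub by blast
        then show ?thesis by (simp add: F_def)
      qed (use R in \<open>auto simp: bump_outside dist_norm\<close>)
    qed simp
    finally show ?thesis using C by (simp add: field_simps)
  qed
  \<comment> \<open>\<open>G\<close> is the gradient of \<open>bump 3 R\<close>, with
    \<open>6 = 2 * 3\<close>, and \<open>GG i\<close> is the gradient of its component along
    \<open>i\<close>, with \<open>24 = 6 * 4\<close>. The lowest exponent left is \<open>1\<close>,
    for which the kernel is still continuous.\<close>
  define G where "G z = (- 6 * bump 2 R z) *\<^sub>R z" for z :: 'a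
  define GG where "GG i z = (- 6 * bump 2 R z) *\<^sub>R i + (24 * bump 1 R z * (z \<bullet> i)) *\<^sub>R z" for i z :: 'a
  define g where "g x = (1 / C) *\<^sub>R (\<integral>y. F y *\<^sub>R G (x - y) \<partial>lborel)" for x
  define H where "H i x = (1 / C) *\<^sub>R (\<integral>y. F y *\<^sub>R GG i (x - y) \<partial>lborel)" for i x
  have d3: "(bump 3 R has_derivative (\<lambda>h. h \<bullet> G z)) (at z)" for z :: 'a
    using has_derivative_bump[of z R 2] by (simp add: numeral_2_eq_2 numeral_3_eq_3 G_def)
  have d2: "(bump 2 R has_derivative (\<lambda>h. h \<bullet> ((- 4 * bump 1 R z) *\<^sub>R z))) (at z)" for z :: 'a
    using has_derivative_bump[of z R 1] by (simp add: numeral_2_eq_2)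
  have dG: "((\<lambda>z. G z \<bullet> i) has_derivative (\<lambda>h. h \<bullet> GG i z)) (at z)" for i z :: 'a
    unfolding G_def inner_scaleR_left
    by (rule derivative_eq_intros d2 refl)+ (simp add: fun_eq_iff GG_def algebra_simps inner_commute)
  have contG: "continuous_on UNIV G" and contGG: "continuous_on UNIV (GG i)" for i
    unfolding G_def GG_def by (intro continuous_intros continuous_on_bump; simp)+
  have out: "bump 3 R z = 0" "G z = 0" "GG i z = 0" if "R \<le> norm z" for i z :: 'a
    using that R by (simp_all add: G_def GG_def bump_outside)
  \<comment> \<open>\<open>g\<close> and \<open>H\<close> are vector-valued integrals. Their
    components are scalar convolutions, to which the results on derivative and continuity of
    \<open>convolution\<close> apply again.\<close>
  have inner_int: "(\<integral>y. F y *\<^sub>R k (x - y) \<partial>lborel) \<bullet> i = convolution F (\<lambda>z. k z \<bullet> i) x"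
    if k: "continuous_on UNIV k" "\<And>z. R \<le> norm z \<Longrightarrow> k z = 0" for k :: "'a \<Rightarrow> 'a" and x i
  proof -
    obtain B where "\<And>z. norm (k z) \<le> B"
      using continuous_compact_support_bounded[OF k] by metis
    then have "integrable lborel (\<lambda>y. F y *\<^sub>R k (x - y))"
      using k(1) by (intro integrable_convolution F)
    then show ?thesis
      by (simp add: convolution_def flip: integral_inner_left)
  qed
  have "has_gradient_hessian f g H (ball x0 R)"
    unfolding has_gradient_hessian_def
  proof (intro conjI ballI)
    fix x assume x: "x \<in> ball x0 R"
    have "(convolution F (bump 3 R) has_derivative (\<lambda>h. h \<bullet> (\<integral>y. F y *\<^sub>R G (x - y) \<partial>lborel))) (at x)"
      using F d3 out contG by (intro has_derivative_convolution) auto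
    then have "((\<lambda>x. (1 / C) * convolution F (bump 3 R) x) has_derivative (\<lambda>h. h \<bullet> g x)) (at x)"
      using has_derivative_mult_right[of _ _ _ "1 / C"] by (fastforce simp: g_def)
    then show "(f has_derivative (\<lambda>h. h \<bullet> g x)) (at x)"
      by (rule has_derivative_transform_within_open[of _ _ _ _ "ball x0 R"]) (use x f_eq in auto)
  next
    fix i x :: 'a
    have "(convolution F (\<lambda>z. G z \<bullet> i) has_derivative (\<lambda>h. h \<bullet> (\<integral>y. F y *\<^sub>R GG i (x - y) \<partial>lborel))) (at x)"
      by (intro has_derivative_convolution[OF F dG _ contGG out(3)]) (simp_all add: out(2))
    then have "((\<lambda>x. (1 / C) * convolution F (\<lambda>z. G z \<bullet> i) x) has_derivative (\<lambda>h. h \<bullet> H i x)) (at x)"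
      using has_derivative_mult_right[of _ _ _ "1 / C"] by (fastforce simp: H_def)
    then show "((\<lambda>y. g y \<bullet> i) has_derivative (\<lambda>h. h \<bullet> H i x)) (at x)"
      unfolding g_def using inner_int[OF contG out(2)] by simp
  next
    fix i :: 'a
    have "continuous_on (ball x0 R) (\<lambda>x. H i x \<bullet> j)" for j
    proof -
      have contj: "continuous_on UNIV (\<lambda>z. GG i z \<bullet> j)" by (intro continuous_intros contGG)
      obtain B where "\<And>z. norm (GG i z \<bullet> j) \<le> B"
        using continuous_compact_support_bounded[OF contj, of R] out(3) inner_zero_left by metis
      then have "continuous_on (ball x0 R) (convolution F (\<lambda>z. GG i z \<bullet> j))"
        using F contj by (intro continuous_on_convolution) auto
      then show ?thesis
        unfolding H_def using inner_int[OF contGG out(3)] C by (auto intro!: continuous_intros)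
    qed
    then show "continuous_on (ball x0 R) (H i)"
      using continuous_on_componentwise[of "ball x0 R" "H i"] by blast
  qed
  moreover have "ball x0 R \<subseteq> D" using r by (auto simp: R_def)
  ultimately show ?thesis using that[of "ball x0 R"] R by auto
qed

section \<open>Passage between \<open>Ck_on 2\<close> and gradient and Hessian data\<close>

lemma partial_deriv_eq:
  "(f has_derivative (\<lambda>h. h \<bullet> g)) (at x) \<Longrightarrow> partial_deriv i f x = i \<bullet> g"
  unfolding partial_deriv_def using frechet_derivative_at by metis

text \<open>The data \<open>g\<close> and \<open>H\<close> may change from point to point. On the
  open set \<open>S\<close> they are expressed by the globally defined \<open>partial_deriv\<close>,
  so the local pieces fit together, and differentiability and continuity are local.\<close>

lemma Ck_on_2_if_has_gradient_hessian:
  assumes "\<And>x. x \<in> D \<Longrightarrow> \<exists>S g H. open S \<and> x \<in> S \<and> has_gradient_hessian f g H S"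
  shows "Ck_on 2 f D"
    and "open S \<Longrightarrow> has_gradient_hessian f g H S \<Longrightarrow> x \<in> S \<Longrightarrow> laplacian f x = (\<Sum>i\<in>Basis. H i x \<bullet> i)"
proof -
  have pd: "partial_deriv i f y = g y \<bullet> i"
    if "has_gradient_hessian f g H S" "y \<in> S" for S g H y i
    using that unfolding has_gradient_hessian_def by (metis inner_commute partial_deriv_eq)
  have pd': "(partial_deriv i f has_derivative (\<lambda>h. h \<bullet> H i y)) (at y)"
    if "open S" "has_gradient_hessian f g H S" "y \<in> S" "i \<in> Basis" for S g H y i
  proof (rule has_derivative_transform_within_open[OF _ that(1,3)])
    show "((\<lambda>y. g y \<bullet> i) has_derivative (\<lambda>h. h \<bullet> H i y)) (at y)"
      using that unfolding has_gradient_hessian_def by blast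
  qed (use pd[OF that(2)] in simp)
  have ppd: "partial_deriv j (partial_deriv i f) y = H i y \<bullet> j"
    if "open S" "has_gradient_hessian f g H S" "y \<in> S" "i \<in> Basis" for S g H y i j
    using partial_deriv_eq[OF pd'[OF that], of j] by (simp add: inner_commute)
  show "laplacian f x = (\<Sum>i\<in>Basis. H i x \<bullet> i)"
    if "open S" "has_gradient_hessian f g H S" "x \<in> S" for S g H x
    unfolding laplacian_def using ppd[OF that] by simp
  show "Ck_on 2 f D"
    unfolding numeral_2_eq_2 Ck_on.simps
  proof (intro conjI ballI)
    fix x assume "x \<in> D"
    then obtain S g H where S: "open S" "x \<in> S" "has_gradient_hessian f g H S" using assms by blast
    then show "f differentiable at x"
      unfolding has_gradient_hessian_def differentiable_def by blast
    show "partial_deriv i f differentiable at x" if "i \<in> Basis" for i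
      using pd'[OF S(1,3,2) that] unfolding differentiable_def by blast
  next
    fix i j :: 'a assume i: "i \<in> Basis"
    show "continuous_on D (partial_deriv j (partial_deriv i f))"
    proof (rule continuous_at_imp_continuous_on, rule ballI)
      fix x assume "x \<in> D"
      then obtain S g H where S: "open S" "x \<in> S" "has_gradient_hessian f g H S" using assms by blast
      have "continuous_on S (\<lambda>y. H i y \<bullet> j)"
        using S i unfolding has_gradient_hessian_def by (intro continuous_intros) auto
      then have "continuous_on S (partial_deriv j (partial_deriv i f))"
        by (rule continuous_on_eq) (use ppd[OF S(1,3) _ i] in auto)
      then show "isCont (partial_deriv j (partial_deriv i f)) x"
        using S continuous_on_eq_continuous_at by blast
    qed
  qed
qed

lemma has_derivative_partial_deriv:
  assumes "f differentiable at x"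
  shows "(f has_derivative (\<lambda>h. h \<bullet> (\<Sum>i\<in>Basis. partial_deriv i f x *\<^sub>R i))) (at x)"
proof -
  let ?f = "frechet_derivative f (at x)"
  have f: "(f has_derivative ?f) (at x)" using assms frechet_derivative_works by blast
  then have lin: "linear ?f" by (rule has_derivative_linear)
  have "?f h = h \<bullet> (\<Sum>i\<in>Basis. partial_deriv i f x *\<^sub>R i)" for h
  proof -
    have "?f h = ?f (\<Sum>i\<in>Basis. (h \<bullet> i) *\<^sub>R i)" by (simp add: euclidean_representation)
    also have "\<dots> = (\<Sum>i\<in>Basis. (h \<bullet> i) * ?f i)"
      using lin by (simp add: linear_sum linear_scale)
    finally show ?thesis by (simp add: inner_sum_right partial_deriv_def mult.commute)
  qed
  then show ?thesis using f by (metis (no_types, lifting) ext)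
qed

text \<open>\<open>g\<close> and \<open>H\<close> are assembled from the total functions
  \<open>partial_deriv\<close>, so the formula for \<open>laplacian\<close> is an identity at every
  point, inside \<open>D\<close> or not.\<close>

lemma has_gradient_hessian_if_Ck_on_2:
  assumes "Ck_on 2 f D"
  obtains g H where "has_gradient_hessian f g H D" "\<And>y. laplacian f y = (\<Sum>i\<in>Basis. H i y \<bullet> i)"
proof -
  define g where "g y = (\<Sum>i\<in>Basis. partial_deriv i f y *\<^sub>R i)" for y
  define H where "H i y = (\<Sum>j\<in>Basis. partial_deriv j (partial_deriv i f) y *\<^sub>R j)" for i y
  have C: "\<And>x. x \<in> D \<Longrightarrow> f differentiable at x"
    "\<And>x i. x \<in> D \<Longrightarrow> i \<in> Basis \<Longrightarrow> partial_deriv i f differentiable at x"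
    "\<And>i j. i \<in> Basis \<Longrightarrow> j \<in> Basis \<Longrightarrow> continuous_on D (partial_deriv j (partial_deriv i f))"
    using assms unfolding numeral_2_eq_2 Ck_on.simps by auto
  have gi: "(\<lambda>y. g y \<bullet> i) = partial_deriv i f" if "i \<in> Basis" for i
    using that by (simp add: g_def fun_eq_iff inner_sum_left inner_Basis if_distrib cong: if_cong)
  have "has_gradient_hessian f g H D"
    unfolding has_gradient_hessian_def
  proof (intro conjI ballI)
    show "continuous_on D (H i)" if "i \<in> Basis" for i
      unfolding H_def using C(3) that by (intro continuous_intros) auto
    show "(f has_derivative (\<lambda>h. h \<bullet> g y)) (at y)" if "y \<in> D" for y
      unfolding g_def by (intro has_derivative_partial_deriv C that)
    show "((\<lambda>y. g y \<bullet> i) has_derivative (\<lambda>h. h \<bullet> H i y)) (at y)" if "i \<in> Basis" "y \<in> D" for i y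
      unfolding H_def gi[OF that(1)] by (intro has_derivative_partial_deriv C that)
  qed
  moreover have "laplacian f y = (\<Sum>i\<in>Basis. H i y \<bullet> i)" for y
    by (simp add: laplacian_def H_def inner_sum_left inner_Basis if_distrib cong: if_cong)
  ultimately show ?thesis using that by blast
qed

subsection \<open>Quasinearly subharmonic functions\<close>

text \<open>\<open>ennreal\<close> sends negative reals to \<open>0\<close> and so performs the
  maximum with \<open>0\<close>; finiteness of \<open>u\<close> on \<open>S\<close> ensures that
  \<open>real_of_ereal\<close> loses no information there.\<close>

lemma nn_integral_pos_part:
  assumes "\<And>y. y \<in> S \<Longrightarrow> \<bar>u y\<bar> \<noteq> \<infinity>"
  shows "(\<integral>\<^sup>+y\<in>S. e2ennreal (max (u y) 0) \<partial>M) = (\<integral>\<^sup>+y. ennreal (indicator S y * real_of_ereal (u y)) \<partial>M)"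
proof (rule nn_integral_cong)
  fix y
  show "e2ennreal (max (u y) 0) * indicator S y = ennreal (indicator S y * real_of_ereal (u y))"
  proof (cases "y \<in> S")
    case True
    then obtain a where a: "u y = ereal a" using assms[of y] by (cases "u y") auto
    have "e2ennreal (max (ereal a) 0) = ennreal a"
      by (cases "a \<ge> 0") (auto simp: max_def e2ennreal_neg ennreal_neg)
    then show ?thesis using True a by simp
  qed simp
qed

lemma nn_integral_neg_part:
  assumes "\<And>y. y \<in> S \<Longrightarrow> \<bar>u y\<bar> \<noteq> \<infinity>"
  shows "(\<integral>\<^sup>+y\<in>S. e2ennreal (max (- u y) 0) \<partial>M) = (\<integral>\<^sup>+y. ennreal (- (indicator S y * real_of_ereal (u y))) \<partial>M)"
  using nn_integral_pos_part[of S "\<lambda>y. - u y"] assms by (simp add: real_of_ereal_minus)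

lemma ereal_integral_on_eq:
  assumes "\<And>y. y \<in> S \<Longrightarrow> \<bar>u y\<bar> \<noteq> \<infinity>"
    and int: "integrable lebesgue (\<lambda>y. indicator S y * real_of_ereal (u y))"
  shows "ereal_integral_on S u = ereal (\<integral>y. indicator S y * real_of_ereal (u y) \<partial>lebesgue)"
proof -
  have pos: "(\<integral>\<^sup>+y\<in>S. e2ennreal (max (u y) 0) \<partial>lebesgue) = (\<integral>\<^sup>+y. ennreal (indicator S y * real_of_ereal (u y)) \<partial>lebesgue)"
    using assms(1) by (rule nn_integral_pos_part)
  have neg: "(\<integral>\<^sup>+y\<in>S. e2ennreal (max (- u y) 0) \<partial>lebesgue) = (\<integral>\<^sup>+y. ennreal (- (indicator S y * real_of_ereal (u y))) \<partial>lebesgue)"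
    using assms(1) by (rule nn_integral_neg_part)
  show ?thesis
    using int unfolding ereal_integral_on_def pos neg by (rule integrableE) simp
qed

lemma integral_bump_0_const:
  fixes x :: "'a::euclidean_space"
  assumes "0 \<le> r"
  shows "(\<integral>y. bump 0 r (x - y) \<partial>lborel) = measure lebesgue (ball (0::'a) 1) * r ^ DIM('a)"
  using integral_bump_0[OF assms, of x "\<lambda>_. 1"] content_ball_conv_unit_ball[OF assms, of x]
  by (simp add: measure_completion mult.commute)

text \<open>Quasinearly subharmonic functions are integrated over \<open>lebesgue\<close>, the
  kernels over \<open>lborel\<close>. The two integrals agree here because continuity of
  \<open>f\<close> makes the integrand Borel measurable.\<close>

lemma lebesgue_integral_bump_times:
  fixes f :: "'a::euclidean_space \<Rightarrow> real"
  assumes "continuous_on (cball x R) f" "0 \<le> R"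
  shows "(\<integral>y. bump k R (x - y) * f y \<partial>lebesgue) = (\<integral>y. bump k R (x - y) * f y \<partial>lborel)"
  by (intro integral_completion borel_measurable_integrable integrable_bump_times assms)

lemma indicator_ball_eq_bump:
  "0 \<le> r \<Longrightarrow> indicator (ball x r) y = bump 0 r (x - y)"
  by (simp add: bump_0 indicator_def dist_norm norm_minus_commute)

text \<open>With equality in the mean value formula the constant \<open>1\<close> works. The
  hypotheses are invariant under a change of sign, so the result applies to \<open>u\<close> and to
  \<open>- u\<close>.\<close>

lemma K_quasinearly_subharmonic_ns_if_mean_value:
  fixes u :: "'a::euclidean_space \<Rightarrow> ereal"
  assumes D: "open D" and fin: "\<And>x. x \<in> D \<Longrightarrow> \<bar>u x\<bar> \<noteq> \<infinity>"
    and cont: "continuous_on D (\<lambda>x. real_of_ereal (u x))"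
    and mean: "\<And>x r. 0 < r \<Longrightarrow> cball x r \<subseteq> D \<Longrightarrow>
      (\<integral>y. bump 0 r (x - y) * real_of_ereal (u y) \<partial>lborel) = real_of_ereal (u x) * (\<integral>y. bump 0 r (x - y) \<partial>lborel)"
  shows "K_quasinearly_subharmonic_ns 1 u D"
  unfolding K_quasinearly_subharmonic_ns_def pos_part_locally_integrable_on_def
proof (intro conjI allI impI ballI; (elim conjE)?)
  show "u x \<noteq> \<infinity>" if "x \<in> D" for x using fin[OF that] by auto
  have "(\<lambda>x. real_of_ereal (u x)) \<in> borel_measurable (lebesgue_on D)"
    using cont D by (intro continuous_imp_measurable_on_sets_lebesgue) auto
  then have "(\<lambda>x. ereal (real_of_ereal (u x))) \<in> borel_measurable (lebesgue_on D)" by simp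
  moreover have "u x = ereal (real_of_ereal (u x))" if "x \<in> space (lebesgue_on D)" for x
    using fin[of x] that by (simp add: ereal_real)
  ultimately show "u \<in> borel_measurable (lebesgue_on D)"
    using measurable_cong[of "lebesgue_on D" u "\<lambda>x. ereal (real_of_ereal (u x))" borel] by blast
next
  fix C assume C: "compact C" "C \<subseteq> D"
  have "integrable lborel (\<lambda>y. indicator C y *\<^sub>R real_of_ereal (u y))"
    using C cont by (intro borel_integrable_compact continuous_on_subset[OF cont])
  then have "integrable lebesgue (\<lambda>y. indicator C y * real_of_ereal (u y))"
    by (simp add: integrable_completion borel_measurable_integrable)
  then have "(\<integral>\<^sup>+y. ennreal (indicator C y * real_of_ereal (u y)) \<partial>lebesgue) \<noteq> \<infinity>"
    by (simp add: real_integrable_def)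
  moreover have "(\<integral>\<^sup>+y\<in>C. e2ennreal (max (u y) 0) \<partial>lebesgue)
      = (\<integral>\<^sup>+y. ennreal (indicator C y * real_of_ereal (u y)) \<partial>lebesgue)"
    by (intro nn_integral_pos_part fin) (use C in auto)
  ultimately show "(\<integral>\<^sup>+y\<in>C. e2ennreal (max (u y) 0) \<partial>lebesgue) < \<infinity>"
    by (simp add: top.not_eq_extremum)
next
  fix x r assume r: "r > 0" "cball x r \<subseteq> D"
  define v where "v y = real_of_ereal (u y)" for y
  define c where "c = measure lebesgue (ball (0::'a) 1) * r ^ DIM('a)"
  have c: "c > 0" using r content_ball_pos[of 1 "0::'a"] by (simp add: c_def)
  have contr: "continuous_on (cball x r) v"
    using r cont unfolding v_def by (auto intro: continuous_on_subset)
  have ind: "indicator (ball x r) y * v y = bump 0 r (x - y) * v y" for y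
    using r by (simp add: indicator_ball_eq_bump)
  have "integrable lborel (\<lambda>y. bump 0 r (x - y) * v y)"
    using r contr by (intro integrable_bump_times) auto
  then have int: "integrable lebesgue (\<lambda>y. indicator (ball x r) y * v y)"
    by (simp add: ind integrable_completion borel_measurable_integrable)
  have "ereal_integral_on (ball x r) u = ereal (\<integral>y. indicator (ball x r) y * v y \<partial>lebesgue)"
    unfolding v_def
  proof (rule ereal_integral_on_eq)
    show "\<bar>u y\<bar> \<noteq> \<infinity>" if "y \<in> ball x r" for y
      using fin[of y] r(2) that by (auto simp: subset_iff)
  qed (use int in \<open>simp add: v_def\<close>)
  also have "(\<integral>y. indicator (ball x r) y * v y \<partial>lebesgue) = v x * c"
    unfolding ind using mean[OF r] r lebesgue_integral_bump_times[OF contr, of 0] integral_bump_0_const[of r x]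
    by (simp add: v_def c_def)
  finally have "ereal (1 / c) * ereal_integral_on (ball x r) u = ereal (v x)"
    using c by simp
  moreover have "u x = ereal (v x)"
    using fin[of x] r centre_in_cball[of x r] by (simp add: v_def ereal_real subset_iff)
  ultimately show "u x \<le> ereal (1 / (measure lebesgue (ball (0::'a) 1) * r ^ DIM('a))) * ereal_integral_on (ball x r) u"
    by (simp add: c_def)
qed

text \<open>The condition on \<open>u\<close> controls the positive part on compact sets, and the
  condition on \<open>- u\<close> controls the negative part.\<close>

lemma integrable_if_quasinearly_subharmonic_ns:
  fixes u :: "'a::euclidean_space \<Rightarrow> ereal"
  assumes D: "open D" and fin: "\<And>x. x \<in> D \<Longrightarrow> \<bar>u x\<bar> \<noteq> \<infinity>"
    and K1: "K_quasinearly_subharmonic_ns K1 u D"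
    and K2: "K_quasinearly_subharmonic_ns K2 (\<lambda>x. - u x) D"
    and C: "compact C" "C \<subseteq> D"
  shows "integrable lebesgue (\<lambda>y. indicator C y * real_of_ereal (u y))"
  unfolding real_integrable_def
proof (intro conjI)
  have finC: "\<bar>u y\<bar> \<noteq> \<infinity>" if "y \<in> C" for y by (rule fin) (use that C in auto)
  have "u \<in> borel_measurable (lebesgue_on D)"
    using K1 unfolding K_quasinearly_subharmonic_ns_def by blast
  then have "u \<in> borel_measurable (lebesgue_on C)"
    using C(2) by (rule measurable_restrict_mono)
  then have "(\<lambda>y. real_of_ereal (u y)) \<in> borel_measurable (lebesgue_on C)" by simp
  moreover have "C \<in> sets lebesgue" using C(1) by (simp add: borel_compact)
  ultimately show "(\<lambda>y. indicator C y * real_of_ereal (u y)) \<in> borel_measurable lebesgue"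
    using borel_measurable_restrict_space_iff[of C lebesgue "\<lambda>y. real_of_ereal (u y)"] by simp
  have "(\<integral>\<^sup>+y\<in>C. e2ennreal (max (u y) 0) \<partial>lebesgue) < \<infinity>"
    using K1 C unfolding K_quasinearly_subharmonic_ns_def pos_part_locally_integrable_on_def by blast
  then show "(\<integral>\<^sup>+y. ennreal (indicator C y * real_of_ereal (u y)) \<partial>lebesgue) \<noteq> \<infinity>"
    using nn_integral_pos_part[of C u lebesgue, OF finC] by simp
  have "(\<integral>\<^sup>+y\<in>C. e2ennreal (max (- u y) 0) \<partial>lebesgue) < \<infinity>"
    using K2 C unfolding K_quasinearly_subharmonic_ns_def pos_part_locally_integrable_on_def by blast
  then show "(\<integral>\<^sup>+y. ennreal (- (indicator C y * real_of_ereal (u y))) \<partial>lebesgue) \<noteq> \<infinity>"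
    using nn_integral_neg_part[of C u lebesgue, OF finC] by simp
qed

text \<open>Integrability makes the extended integral a real number, so the defining inequality can
  be read in the reals.\<close>

lemma K_quasinearly_subharmonic_ns_le:
  fixes u :: "'a::euclidean_space \<Rightarrow> ereal"
  assumes fin: "\<And>x. x \<in> D \<Longrightarrow> \<bar>u x\<bar> \<noteq> \<infinity>"
    and K: "K_quasinearly_subharmonic_ns K u D"
    and int: "integrable lebesgue (\<lambda>y. indicator (cball x r) y * real_of_ereal (u y))"
    and r: "0 < r" "cball x r \<subseteq> D"
  shows "real_of_ereal (u x) \<le> K / (measure lebesgue (ball (0::'a) 1) * r ^ DIM('a)) *
    (\<integral>y. bump 0 r (x - y) * real_of_ereal (u y) \<partial>lebesgue)"
proof -
  have "integrable lebesgue (\<lambda>y. indicator (ball x r) y *\<^sub>R (indicator (cball x r) y * real_of_ereal (u y)))"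
    using int by (intro integrable_mult_indicator) auto
  also have "(\<lambda>y. indicator (ball x r) y *\<^sub>R (indicator (cball x r) y * real_of_ereal (u y)))
      = (\<lambda>y. indicator (ball x r) y * real_of_ereal (u y))"
    by (auto simp: indicator_def)
  finally have "ereal_integral_on (ball x r) u = ereal (\<integral>y. indicator (ball x r) y * real_of_ereal (u y) \<partial>lebesgue)"
    using fin r(2) by (intro ereal_integral_on_eq) (auto simp: subset_iff)
  also have "(\<integral>y. indicator (ball x r) y * real_of_ereal (u y) \<partial>lebesgue)
      = (\<integral>y. bump 0 r (x - y) * real_of_ereal (u y) \<partial>lebesgue)"
    using r by (simp add: indicator_ball_eq_bump)
  finally have "u x \<le> ereal (K / (measure lebesgue (ball (0::'a) 1) * r ^ DIM('a)) *
      (\<integral>y. bump 0 r (x - y) * real_of_ereal (u y) \<partial>lebesgue))"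
    using K r unfolding K_quasinearly_subharmonic_ns_def by (metis times_ereal.simps(1))
  moreover have "u x = ereal (real_of_ereal (u x))"
    using fin[of x] r centre_in_cball[of x r] by (simp add: ereal_real subset_iff)
  ultimately show ?thesis by (metis ereal_less_eq(3))
qed

text \<open>Here regularity is gained: \<open>F\<close> is only integrable. When the centre moves to
  \<open>a\<close>, the indicators of the balls are eventually constant at each point off the
  limiting sphere, and that sphere is a null set.\<close>

lemma isCont_integral_ball:
  fixes F :: "'a::euclidean_space \<Rightarrow> real"
  assumes "integrable lebesgue F" "0 \<le> r"
  shows "isCont (\<lambda>x. \<integral>y. bump 0 r (x - y) * F y \<partial>lebesgue) a"
proof (rule continuous_at_sequentiallyI)
  fix X assume X: "X \<longlonglongrightarrow> a"
  have meas: "(\<lambda>y. bump 0 r (x - y) * F y) \<in> borel_measurable lebesgue" for x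
  proof -
    have "(\<lambda>y. bump 0 r (x - y)) \<in> borel_measurable lebesgue"
      by (rule measurable_completion) measurable
    then show ?thesis using assms(1) by measurable
  qed
  show "(\<lambda>n. \<integral>y. bump 0 r (X n - y) * F y \<partial>lebesgue) \<longlonglongrightarrow> (\<integral>y. bump 0 r (a - y) * F y \<partial>lebesgue)"
  proof (rule integral_dominated_convergence)
    show "integrable lebesgue (\<lambda>y. \<bar>F y\<bar>)" using assms by simp
    show "AE y in lebesgue. (\<lambda>n. bump 0 r (X n - y) * F y) \<longlonglongrightarrow> bump 0 r (a - y) * F y"
      using AE_completion[OF AE_not_sphere[of a r]]
    proof eventually_elim
      case (elim y)
      have lim: "(\<lambda>n. norm (X n - y)) \<longlonglongrightarrow> norm (a - y)"
        by (intro tendsto_intros X)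
      have "\<forall>\<^sub>F n in sequentially. bump 0 r (X n - y) = bump 0 r (a - y)"
      proof (cases "norm (a - y) < r")
        case True
        from order_tendstoD(2)[OF lim this] show ?thesis
          by eventually_elim (use True in \<open>simp add: bump_inside\<close>)
      next
        case False
        then have "norm (a - y) > r" using elim by simp
        from order_tendstoD(1)[OF lim this] show ?thesis
          by eventually_elim (use False assms in \<open>simp add: bump_outside\<close>)
      qed
      then show ?case
        by (intro tendsto_mult tendsto_const tendsto_eventually)
    qed
    show "AE y in lebesgue. norm (bump 0 r (X n - y) * F y) \<le> \<bar>F y\<bar>" for n
      using bump_le[of 0 r] bump_nonneg[of 0 r]
      by (auto intro!: AE_I2 mult_left_le_one_le simp: abs_mult abs_of_nonneg[OF bump_nonneg])
  qed (use meas in auto)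
qed

text \<open>\<open>K1\<close> and \<open>K2\<close> are the same for all balls in \<open>D\<close>,
  so one ball about \<open>x1\<close> and one about \<open>x2\<close> decide \<open>K1 = K2\<close>,
  and the two-sided estimate becomes an equality everywhere. The means are taken over
  \<open>lebesgue\<close> until continuity of \<open>v\<close> allows the change to
  \<open>lborel\<close>.\<close>

lemma mean_value_if_quasinearly_subharmonic_ns:
  fixes u :: "'a::euclidean_space \<Rightarrow> ereal"
  assumes D: "open D" and fin: "\<And>x. x \<in> D \<Longrightarrow> \<bar>u x\<bar> \<noteq> \<infinity>"
    and K: "K1 \<ge> 1" "K2 \<ge> 1"
    and K1: "K_quasinearly_subharmonic_ns K1 u D"
    and K2: "K_quasinearly_subharmonic_ns K2 (\<lambda>x. - u x) D"
    and x12: "x1 \<in> D" "x2 \<in> D" "u x1 > 0" "u x2 < 0"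
  defines "v \<equiv> \<lambda>x. real_of_ereal (u x)"
  shows "continuous_on D v"
    and "0 < r \<Longrightarrow> cball x r \<subseteq> D \<Longrightarrow> (\<integral>y. bump 0 r (x - y) * (v y - v x) \<partial>lborel) = 0"
proof -
  define c where "c r = measure lebesgue (ball (0::'a) 1) * r ^ DIM('a)" for r
  have c: "c r > 0" if "r > 0" for r
    using that content_ball_pos[of 1 "0::'a"] by (simp add: c_def)
  define A where "A x r = (\<integral>y. bump 0 r (x - y) * v y \<partial>lebesgue)" for x r
  have int: "integrable lebesgue (\<lambda>y. indicator (cball x r) y * v y)" if "cball x r \<subseteq> D" for x r
    unfolding v_def
    using that by (intro integrable_if_quasinearly_subharmonic_ns[OF D fin K1 K2]) auto
  have upper: "v x \<le> K1 / c r * A x r" if "0 < r" "cball x r \<subseteq> D" for x r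
    using K_quasinearly_subharmonic_ns_le[OF fin K1 _ that] int[OF that(2)]
    by (simp add: v_def A_def c_def)
  have lower: "K2 / c r * A x r \<le> v x" if "0 < r" "cball x r \<subseteq> D" for x r
    using K_quasinearly_subharmonic_ns_le[OF _ K2 _ that] int[OF that(2)] fin
    by (simp add: v_def A_def c_def real_of_ereal_minus)
  have ex_ball: "\<exists>r>0. cball x r \<subseteq> D" if "x \<in> D" for x
    using D that open_contains_cball by blast
  have "v x1 > 0" "v x2 < 0"
    using x12 fin[of x1] fin[of x2] by (auto simp: v_def real_of_ereal_pos zero_less_real_of_ereal; cases "u x2"; simp)+
  \<comment> \<open>As \<open>v x1 > 0\<close> and \<open>K1 > 0\<close>, the upper estimate makes
    the mean at \<open>x1\<close> positive, and dividing by it compares the constants. At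
    \<open>x2\<close> the lower estimate makes the mean negative, which reverses the
    comparison.\<close>
  have "K2 \<le> K1"
  proof -
    obtain r where r: "r > 0" "cball x1 r \<subseteq> D" using ex_ball x12 by blast
    have "0 < K1 / c r * A x1 r" using upper[OF r] \<open>v x1 > 0\<close> by linarith
    then have "A x1 r > 0" using K c[OF r(1)] by (simp add: zero_less_mult_iff zero_less_divide_iff)
    moreover have "K2 / c r * A x1 r \<le> K1 / c r * A x1 r" using upper[OF r] lower[OF r] by linarith
    ultimately show ?thesis using c[OF r(1)] by (simp add: divide_le_cancel)
  qed
  moreover have "K1 \<le> K2"
  proof -
    obtain r where r: "r > 0" "cball x2 r \<subseteq> D" using ex_ball x12 by blast
    have "K2 / c r * A x2 r < 0" using lower[OF r] \<open>v x2 < 0\<close> by linarith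
    then have "A x2 r < 0" using K c[OF r(1)] by (simp add: mult_less_0_iff divide_less_0_iff)
    moreover have "K2 / c r * A x2 r \<le> K1 / c r * A x2 r" using upper[OF r] lower[OF r] by linarith
    ultimately show ?thesis using c[OF r(1)] by (simp add: divide_le_cancel)
  qed
  ultimately have "K2 = K1" by simp
  have v_eq: "v x = K1 / c r * A x r" if "0 < r" "cball x r \<subseteq> D" for x r
    using upper[OF that] lower[OF that] \<open>K2 = K1\<close> by simp
  have isCont_v: "isCont v a" if "a \<in> D" for a
  proof -
    obtain r' where r': "r' > 0" "cball a r' \<subseteq> D" using ex_ball \<open>a \<in> D\<close> by blast
    \<comment> \<open>The radius stays fixed while \<open>x\<close> varies near \<open>a\<close>;
      half of \<open>r'\<close> keeps all these balls inside \<open>cball a r'\<close>, so one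
      integrable function \<open>F\<close> serves for all of them.\<close>
    define r where "r = r' / 2"
    have r: "r > 0" using r' by (simp add: r_def)
    define F where "F y = indicator (cball a r') y * v y" for y
    have F: "integrable lebesgue F" unfolding F_def[abs_def] using int[OF r'(2)] .
    have eq: "v x = K1 / c r * (\<integral>y. bump 0 r (x - y) * F y \<partial>lebesgue)" if "x \<in> ball a r" for x
    proof -
      have sub: "cball x r \<subseteq> cball a r'"
      proof
        fix y assume "y \<in> cball x r"
        then show "y \<in> cball a r'" using that dist_triangle[of a y x] by (simp add: r_def)
      qed
      have "bump 0 r (x - y) * F y = bump 0 r (x - y) * v y" for y
      proof (cases "y \<in> cball x r")
        case True
        then have "y \<in> cball a r'" using sub by blast
        then show ?thesis by (simp add: F_def)
      qed (use r in \<open>simp add: bump_outside dist_norm\<close>)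
      then have "(\<integral>y. bump 0 r (x - y) * F y \<partial>lebesgue) = A x r"
        unfolding A_def by (intro Bochner_Integration.integral_cong refl)
      moreover have "v x = K1 / c r * A x r" using r sub r' by (intro v_eq) auto
      ultimately show ?thesis by simp
    qed
    have "\<forall>\<^sub>F x in nhds a. x \<in> ball a r" using r by (intro eventually_nhds_in_open) auto
    then have "\<forall>\<^sub>F x in nhds a. v x = K1 / c r * (\<integral>y. bump 0 r (x - y) * F y \<partial>lebesgue)"
      by eventually_elim (rule eq)
    then have "isCont v a \<longleftrightarrow> isCont (\<lambda>x. K1 / c r * (\<integral>y. bump 0 r (x - y) * F y \<partial>lebesgue)) a"
      by (rule isCont_cong)
    moreover have "isCont (\<lambda>x. K1 / c r * (\<integral>y. bump 0 r (x - y) * F y \<partial>lebesgue)) a"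
      using r by (intro continuous_mult continuous_const isCont_integral_ball[OF F]) simp
    ultimately show ?thesis by blast
  qed
  then show cont: "continuous_on D v" by (intro continuous_at_imp_continuous_on) auto
  have mean_diff: "(\<integral>y. bump 0 r (x - y) * (v y - v x) \<partial>lborel) = A x r - v x * c r"
    if "0 < r" "cball x r \<subseteq> D" for x r
  proof -
    have cont': "continuous_on (cball x r) v" using that cont by (auto intro: continuous_on_subset)
    have "integrable lborel (\<lambda>y. bump 0 r (x - y) * v y)" "integrable lborel (\<lambda>y. bump 0 r (x - y) * 1)"
      using that cont' by (intro integrable_bump_times; simp)+
    then show ?thesis
      using that lebesgue_integral_bump_times[OF cont', of 0] integral_bump_0_const[of r x]
      by (simp add: A_def c_def right_diff_distrib)
  qed
  have "K1 = 1"
  proof -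
    \<comment> \<open>By \<open>v_eq\<close> the mean over every small ball about \<open>x1\<close>
      is \<open>v x1 / K1\<close>, while continuity makes these means tend to \<open>v x1\<close>.
      Since \<open>v x1\<close> is not \<open>0\<close>, the constant is \<open>1\<close>.\<close>
    have "\<bar>v x1 / K1 - v x1\<bar> \<le> 0 + \<epsilon>" if "\<epsilon> > 0" for \<epsilon>
    proof -
      obtain d where d: "d > 0" "\<And>y. dist y x1 < d \<Longrightarrow> dist (v y) (v x1) < \<epsilon>"
        using isCont_v[OF x12(1)] \<open>\<epsilon> > 0\<close> unfolding continuous_at_eps_delta by metis
      obtain r' where r': "r' > 0" "cball x1 r' \<subseteq> D" using ex_ball x12 by blast
      define r where "r = min r' d"
      have r: "0 < r" "cball x1 r \<subseteq> D" "r \<le> d"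
        using r' d by (auto simp: r_def subset_iff)
      have "\<bar>\<integral>y. bump 0 r (x1 - y) * (v y - v x1) \<partial>lborel\<bar> \<le> \<epsilon> * (\<integral>y. bump 0 r (x1 - y) \<partial>lborel)"
      proof (rule abs_integral_bump_le)
        show "continuous_on (cball x1 r) (\<lambda>y. v y - v x1)"
          using r cont by (intro continuous_intros) (auto intro: continuous_on_subset)
        show "\<bar>v y - v x1\<bar> \<le> \<epsilon>" if "y \<in> ball x1 r" for y
          using d(2)[of y] that r by (simp add: dist_commute dist_real_def)
      qed (use r in auto)
      then have "\<bar>A x1 r - v x1 * c r\<bar> \<le> \<epsilon> * c r"
        using mean_diff[OF r(1,2)] integral_bump_0_const[of r x1] r by (simp add: c_def)
      moreover have "A x1 r - v x1 * c r = (v x1 / K1 - v x1) * c r"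
        using v_eq[OF r(1,2)] K c[OF r(1)] by (simp add: field_simps)
      ultimately have "\<bar>v x1 / K1 - v x1\<bar> * c r \<le> \<epsilon> * c r"
        using c[OF r(1)] by (simp add: abs_mult)
      then show ?thesis using c[OF r(1)] by simp
    qed
    then have "\<bar>v x1 / K1 - v x1\<bar> \<le> 0" by (rule field_le_epsilon)
    then show ?thesis using K \<open>v x1 > 0\<close> by (simp add: field_simps)
  qed
  show "(\<integral>y. bump 0 r (x - y) * (v y - v x) \<partial>lborel) = 0" if "0 < r" "cball x r \<subseteq> D"
    using mean_diff[OF that] v_eq[OF that] \<open>K1 = 1\<close> c[OF that(1)] by simp
qed

theorem proposition5:
  fixes D :: "(real ^ 'n) set" and u :: "real ^ 'n \<Rightarrow> ereal" and x1 x2 :: "real ^ 'n"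
  assumes "CARD('n) \<ge> 2"
    and "open D" and "connected D"
    and "\<forall>x\<in>D. u x \<noteq> \<infinity>"
    and "x1 \<in> D" and "x2 \<in> D"
    and "u x1 > 0" and "0 > u x2"
  shows "ereal_harmonic_on u D \<longleftrightarrow>
    quasinearly_subharmonic_ns u D \<and> quasinearly_subharmonic_ns (\<lambda>x. - u x) D"
proof
  define v where "v = (\<lambda>x. real_of_ereal (u x))"
  show "quasinearly_subharmonic_ns u D \<and> quasinearly_subharmonic_ns (\<lambda>x. - u x) D"
    if "ereal_harmonic_on u D"
  proof -
    have fin: "\<bar>u x\<bar> \<noteq> \<infinity>" if "x \<in> D" for x
      using \<open>ereal_harmonic_on u D\<close> that by (simp add: ereal_harmonic_on_def)
    have "Ck_on 2 v D" and lap: "\<And>x. x \<in> D \<Longrightarrow> laplacian v x = 0"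
      using that by (auto simp: ereal_harmonic_on_def harmonic_on_def v_def)
    then obtain g H where gH: "has_gradient_hessian v g H D"
      and lap_eq: "\<And>y. laplacian v y = (\<Sum>i\<in>Basis. H i y \<bullet> i)"
      by (metis has_gradient_hessian_if_Ck_on_2)
    have cont: "continuous_on D v" using has_gradient_hessian_continuous_on(1)[OF gH] .
    have mean: "(\<integral>y. bump 0 r (x - y) * v y \<partial>lborel) = v x * (\<integral>y. bump 0 r (x - y) \<partial>lborel)"
      if r: "0 < r" "cball x r \<subseteq> D" for x r
    proof -
      have "(\<integral>y. indicator (ball x r) y * v y \<partial>lborel) = v x * measure lborel (ball x r)"
        using r lap lap_eq by (intro harmonic_mean_value[OF has_gradient_hessian_subset[OF gH]]) auto
      then show ?thesis
        using r integral_bump_0[of r x "\<lambda>_. 1"] by (simp add: integral_bump_0)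
    qed
    have "K_quasinearly_subharmonic_ns 1 u D"
      using assms(2) fin cont mean unfolding v_def
      by (intro K_quasinearly_subharmonic_ns_if_mean_value) auto
    moreover have "K_quasinearly_subharmonic_ns 1 (\<lambda>x. - u x) D"
      using assms(2) fin cont mean unfolding v_def
      by (intro K_quasinearly_subharmonic_ns_if_mean_value) (auto intro!: continuous_intros)
    ultimately show ?thesis unfolding quasinearly_subharmonic_ns_def by blast
  qed
  show "ereal_harmonic_on u D"
    if qns: "quasinearly_subharmonic_ns u D \<and> quasinearly_subharmonic_ns (\<lambda>x. - u x) D"
  proof -
    obtain K1 K2 where K: "K1 \<ge> 1" "K2 \<ge> 1" "K_quasinearly_subharmonic_ns K1 u D"
      "K_quasinearly_subharmonic_ns K2 (\<lambda>x. - u x) D"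
      using qns unfolding quasinearly_subharmonic_ns_def by blast
    \<comment> \<open>The value \<open>-\<infinity>\<close> is excluded through \<open>- u\<close>,
      which must avoid \<open>\<infinity>\<close>.\<close>
    have fin: "\<bar>u x\<bar> \<noteq> \<infinity>" if "x \<in> D" for x
    proof -
      have "u x \<noteq> \<infinity>" "- u x \<noteq> \<infinity>"
        using K that unfolding K_quasinearly_subharmonic_ns_def by blast+
      then show ?thesis by (cases "u x") auto
    qed
    have cont: "continuous_on D v"
      unfolding v_def
      by (rule mean_value_if_quasinearly_subharmonic_ns(1)[OF assms(2) fin K assms(5-8)])
    have mv: "(\<integral>y. bump 0 r (x - y) * (v y - v x) \<partial>lborel) = 0" if "0 < r" "cball x r \<subseteq> D" for x r
      unfolding v_def
      by (rule mean_value_if_quasinearly_subharmonic_ns(2)[OF assms(2) fin K assms(5-8) that])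
    have data: "\<exists>S g H. open S \<and> x \<in> S \<and> S \<subseteq> D \<and> has_gradient_hessian v g H S" if x: "x \<in> D" for x
      using twice_differentiable_if_mean_value[OF assms(2) x cont mv] by metis
    have ex: "\<exists>S g H. open S \<and> x \<in> S \<and> has_gradient_hessian v g H S" if "x \<in> D" for x
      using data[OF that] by blast
    have "laplacian v x = 0" if x: "x \<in> D" for x
    proof -
      obtain S g H where S: "open S" "x \<in> S" "S \<subseteq> D" "has_gradient_hessian v g H S"
        using data[OF x] by blast
      obtain r where r: "r > 0" "cball x r \<subseteq> S" using S open_contains_cball by blast
      have "(\<Sum>i\<in>Basis. H i x \<bullet> i) = 0"
      proof (rule laplacian_eq_0_if_mean_value[OF has_gradient_hessian_subset[OF S(4) r(2)] r(1)])
        fix R assume "0 < R" "R < r"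
        then have "cball x R \<subseteq> cball x r" by (intro subset_cball) auto
        then show "(\<integral>y. bump 0 R (x - y) * (v y - v x) \<partial>lborel) = 0"
          using \<open>0 < R\<close> r S by (intro mv) auto
      qed
      then show ?thesis
        using Ck_on_2_if_has_gradient_hessian(2)[OF ex S(1,4,2)] by simp
    qed
    then show ?thesis
      using fin Ck_on_2_if_has_gradient_hessian(1)[OF ex]
      unfolding ereal_harmonic_on_def harmonic_on_def by (simp add: v_def)
  qed
qed

end
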